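(* Let $f_{15}(p_A,p_B)$ be the first-serving team's advantage in a game to $n=15$ of pickleball doubles with conventional side-out scoring (defined in the context). The function $x\mapsto f_{15}(x,x)$ has exactly seven zeros $x_1<x_2<\cdots<x_7$ in $(0,1)$, which when rounded to six decimal places are $$0.053458,\ 0.247565,\ 0.411942,\ 0.555784,\ 0.685200,\ 0.804458,\ 0.916374.$$ Moreover $f_{15}(x,x)$ is positive for $x$ in $(x_1,x_2)$, $(x_3,x_4)$, $(x_5,x_6)$, and $(x_7,1)$, and negative for $x$ in $(0,x_1)$, $(x_2,x_3)$, $(x_4,x_5)$, and $(x_6,x_7)$. Furthermore $f_{15}(p_A,p_B)>0$ for all $(p_A,p_B)\in(x_3,x_4)\times(x_3,x_4)$; that is, the first-serving team has an advantage there.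
   Context: Side-out scoring chain for a game to $n$ (here $n=15$). Let $p_A$ (resp., $p_B$) be the probability that Team $A$ (resp., Team $B$) wins a rally when serving, with rallies independent and $p_A+p_B>0$. Put $q_A:=1-p_A$, $q_B:=1-p_B$. The score set is $\Sigma_n=(\{0,1,\ldots,n-1\}\times\{0,1,\ldots,n-1\})\cup\{(n-1,n),(n,n-1)\}$. The state space consists of the $4n^2+8$ states $(i,j,k)$ with $(i,j)\in\Sigma_n$ and $k\in\{1,2,3,4\}$, together with two absorbing states, "Team $A$ wins" and "Team $B$ wins". In state $(i,j,k)$, Team $A$ has $i$ points, Team $B$ has $j$ points, and $k$ says that the server is Team $A$'s first server ($k=1$), Team $A$'s second server ($k=2$), Team $B$'s first server ($k=3$), or Team $B$'s second server ($k=4$). Effect of a point for Team $A$ at score $(i,j)$: if $i\le n-2$, the score becomes $(i+1,j)$; if $i=n-1$ and $j\le n-2$, Team $A$ wins; $(n-1,n-1)$ becomes $(n,n-1)$; $(n-1,n)$ becomes $(n-1,n-1)$; at $(n,n-1)$ Team $A$ wins. Effect of a point for Team $B$ at score $(i,j)$: if $j\le n-2$, the score becomes $(i,j+1)$; if $j=n-1$ and $i\le n-2$, Team $B$ wins; $(n-1,n-1)$ becomes $(n-1,n)$; $(n,n-1)$ becomes $(n-1,n-1)$; at $(n-1,n)$ Team $B$ wins. Transitions (one step is one rally): from $(i,j,k)$ with $k\in\{1,2\}$, with probability $p_A$ Team $A$ gets a point and $k$ is unchanged (unless the game ends), and with probability $q_A$ the score is unchanged and $k$ becomes $k+1$. From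 $(i,j,k)$ with $k\in\{3,4\}$, with probability $p_B$ Team $B$ gets a point and $k$ is unchanged (unless the game ends), and with probability $q_B$ the score is unchanged and $k$ becomes $4$ if $k=3$, and $1$ if $k=4$. The initial state is $(0,0,2)$ if Team $A$ serves first and $(0,0,4)$ if Team $B$ serves first. The first-serving team's advantage is $$f_n(p_A,p_B):=\mathrm{P}(\text{Team } A \text{ wins game to } n\mid \text{Team } A \text{ serves first})-\mathrm{P}(\text{Team } A \text{ wins game to } n\mid \text{Team } B \text{ serves first}),$$ where "Team $A$ wins game to $n$" is the event of absorption at "Team $A$ wins". *)

theory Defs
  imports "HOL-Probability.Probability"
begin

section \<open>Path measure of a discrete-time Markov chain\<close>

text \<open>
  A chain with transition kernel \<open>K\<close> started at \<open>s\<close> is driven by a sequence of independent random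
  maps: at each time step a fresh value is drawn from \<open>K x\<close> for every state \<open>x\<close>, and the chain
  moves to the value drawn for its current state. The path \<open>walk s \<omega>\<close> includes the initial state.
  The lemma \<open>chain_measure_cylinder\<close> below shows that \<open>chain_measure K s\<close> is the usual law of the
  chain on sequences of states.
\<close>

primcorec walk :: "'s \<Rightarrow> ('s \<Rightarrow> 's) stream \<Rightarrow> 's stream" where
  "walk s \<omega> = s ## walk (shd \<omega> s) (stl \<omega>)"

definition step_maps :: "('s \<Rightarrow> 's pmf) \<Rightarrow> ('s \<Rightarrow> 's) measure" where
  "step_maps K = (\<Pi>\<^sub>M s\<in>UNIV. measure_pmf (K s))"

definition chain_measure :: "('s \<Rightarrow> 's pmf) \<Rightarrow> 's \<Rightarrow> 's stream measure" where
  "chain_measure K s =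
     distr (stream_space (step_maps K)) (stream_space (count_space UNIV)) (walk s)"

lemma prob_space_step_maps: "prob_space (step_maps K)"
  unfolding step_maps_def by (intro prob_space_PiM measure_pmf.prob_space_axioms)

lemma space_step_maps [simp]: "space (step_maps K) = UNIV"
  by (simp add: step_maps_def space_PiM)

lemma measurable_step_maps_component [measurable]:
  "(\<lambda>f. f s) \<in> measurable (step_maps K) (count_space UNIV)"
proof -
  have "(\<lambda>f. f s) \<in> measurable (step_maps K) (measure_pmf (K s))"
    unfolding step_maps_def by (rule measurable_component_singleton) simp
  then show ?thesis by simp
qed

lemma distr_step_maps_component:
  "distr (step_maps K) (count_space UNIV) (\<lambda>f. f s) = measure_pmf (K s)"
proof -
  have "distr (step_maps K) (measure_pmf (K s)) (\<lambda>f. f s) = measure_pmf (K s)"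
    unfolding step_maps_def
    by (rule distr_PiM_component) (auto intro: measure_pmf.prob_space_axioms)
  moreover have "distr (step_maps K) (measure_pmf (K s)) (\<lambda>f. f s)
      = distr (step_maps K) (count_space UNIV) (\<lambda>f. f s)"
    by (rule distr_cong) simp_all
  ultimately show ?thesis by simp
qed

lemma measurable_walk [measurable]:
  fixes s :: "'s :: countable"
  shows "walk s \<in> measurable (stream_space (step_maps K)) (stream_space (count_space UNIV))"
proof (rule measurable_stream_space2)
  fix n
  show "(\<lambda>\<omega>. walk s \<omega> !! n) \<in> measurable (stream_space (step_maps K)) (count_space UNIV)"
  proof (induction n arbitrary: s)
    case 0
    show ?case by simp
  next
    case (Suc n)
    have "(\<lambda>\<omega>. walk (shd \<omega> s) (stl \<omega>) !! n)
        \<in> measurable (stream_space (step_maps K)) (count_space UNIV)"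
    proof (rule measurable_compose_countable[where f = "\<lambda>x \<omega>. walk x (stl \<omega>) !! n"
          and g = "\<lambda>\<omega>. shd \<omega> s"])
      fix x :: 's
      show "(\<lambda>\<omega>. walk x (stl \<omega>) !! n) \<in> measurable (stream_space (step_maps K)) (count_space UNIV)"
        by (rule measurable_compose[OF measurable_stl Suc.IH])
      show "(\<lambda>\<omega>. shd \<omega> s) \<in> measurable (stream_space (step_maps K)) (count_space UNIV)"
        by (rule measurable_compose[OF measurable_shd measurable_step_maps_component])
    qed
    then show ?case by simp
  qed
qed

lemma prob_space_chain_measure:
  fixes s :: "'s :: countable"
  shows "prob_space (chain_measure K s)"
  unfolding chain_measure_def
  by (intro prob_space.prob_space_distr prob_space.prob_space_stream_space
      prob_space_step_maps measurable_walk)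

text \<open>One-step recursion (conditioning on the first transition).\<close>

lemma emeasure_chain_measure:
  fixes s :: "'s :: countable"
  assumes A [measurable]: "A \<in> sets (stream_space (count_space UNIV))"
  shows "emeasure (chain_measure K s) A =
    (\<integral>\<^sup>+ t. emeasure (chain_measure K t) {\<omega>. s ## \<omega> \<in> A} \<partial>measure_pmf (K s))"
proof -
  let ?S = "stream_space (step_maps K)"
  let ?C = "stream_space (count_space (UNIV :: 's set))"
  interpret F: prob_space "step_maps K" by (rule prob_space_step_maps)
  have [simp]: "space ?S = UNIV" "space ?C = UNIV" by (auto simp: space_stream_space)
  have shift: "{\<omega>. s ## \<omega> \<in> A} \<in> sets ?C"
  proof -
    have "(\<lambda>\<omega>. s ## \<omega>) -` A \<inter> space ?C \<in> sets ?C"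
      by (rule measurable_sets[OF _ A]) simp
    then show ?thesis by (simp add: vimage_def)
  qed
  have pre: "walk s -` A \<inter> space ?S \<in> sets ?S"
    by (rule measurable_sets[OF measurable_walk A])
  have "emeasure (chain_measure K s) A = emeasure ?S (walk s -` A \<inter> space ?S)"
    unfolding chain_measure_def by (rule emeasure_distr[OF measurable_walk A])
  also have "\<dots> = (\<integral>\<^sup>+ f. emeasure ?S {\<omega> \<in> space ?S. f ## \<omega> \<in> walk s -` A \<inter> space ?S} \<partial>step_maps K)"
    by (rule F.emeasure_stream_space[OF pre])
  also have "\<dots> = (\<integral>\<^sup>+ f. emeasure (chain_measure K (f s)) {\<omega>. s ## \<omega> \<in> A} \<partial>step_maps K)"
  proof (rule nn_integral_cong)
    fix f :: "'s \<Rightarrow> 's"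
    have "{\<omega> \<in> space ?S. f ## \<omega> \<in> walk s -` A \<inter> space ?S}
        = walk (f s) -` {\<omega>. s ## \<omega> \<in> A} \<inter> space ?S"
      by (auto simp: walk.code[of s])
    then show "emeasure ?S {\<omega> \<in> space ?S. f ## \<omega> \<in> walk s -` A \<inter> space ?S}
        = emeasure (chain_measure K (f s)) {\<omega>. s ## \<omega> \<in> A}"
      unfolding chain_measure_def by (simp add: emeasure_distr[OF measurable_walk shift])
  qed
  also have "\<dots> = (\<integral>\<^sup>+ t. emeasure (chain_measure K t) {\<omega>. s ## \<omega> \<in> A}
      \<partial>distr (step_maps K) (count_space UNIV) (\<lambda>f. f s))"
    by (subst nn_integral_distr) simp_all
  finally show ?thesis by (simp only: distr_step_maps_component)
qed

lemma chain_measure_cylinder: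
  fixes s :: "'s :: countable"
  shows "measure (chain_measure K s) {\<omega>. \<forall>i\<le>n. \<omega> !! i = x i} =
    (if x 0 = s then \<Prod>i<n. pmf (K (x i)) (x (Suc i)) else 0)"
proof -
  have meas: "{\<omega>. \<forall>i\<le>n. \<omega> !! i = x i} \<in> sets (stream_space (count_space UNIV))"
    for n and x :: "nat \<Rightarrow> 's"
  proof -
    have "{\<omega> \<in> space (stream_space (count_space UNIV)). \<forall>i\<le>n. \<omega> !! i = x i}
        \<in> sets (stream_space (count_space UNIV))"
      by measurable
    then show ?thesis by (simp add: space_stream_space)
  qed
  have "emeasure (chain_measure K s) {\<omega>. \<forall>i\<le>n. \<omega> !! i = x i} =
    ennreal (if x 0 = s then \<Prod>i<n. pmf (K (x i)) (x (Suc i)) else 0)" for s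
  proof (induction n arbitrary: s x)
    case 0
    have one: "emeasure (chain_measure K t) UNIV = 1" for t
      using prob_space.emeasure_space_1[OF prob_space_chain_measure[of K t]]
      by (simp add: chain_measure_def space_stream_space)
    have "{\<omega>. s ## \<omega> \<in> {\<omega>. \<forall>i\<le>0. \<omega> !! i = x i}} = (if x 0 = s then UNIV else {})"
      by auto
    then show ?case
      by (subst emeasure_chain_measure[OF meas])
        (simp only: one if_distrib if_distribR emeasure_empty nn_integral_const nn_integral_0_iff,
          simp add: one measure_pmf.emeasure_space_1[simplified])
  next
    case (Suc n)
    have shift: "{\<omega>. s ## \<omega> \<in> {\<omega>. \<forall>i\<le>Suc n. \<omega> !! i = x i}}
        = (if x 0 = s then {\<omega>. \<forall>i\<le>n. \<omega> !! i = x (Suc i)} else {})"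
      by (auto simp: less_Suc_eq_le[symmetric] All_less_Suc2)
    let ?p = "\<Prod>i<n. pmf (K (x (Suc i))) (x (Suc (Suc i)))"
    have p0: "0 \<le> ?p" by (simp add: prod_nonneg)
    have "(\<integral>\<^sup>+ t. emeasure (chain_measure K t) {\<omega>. \<forall>i\<le>n. \<omega> !! i = x (Suc i)} \<partial>measure_pmf (K s))
        = (\<integral>\<^sup>+ t. ennreal ?p * indicator {x (Suc 0)} t \<partial>measure_pmf (K s))"
      by (intro nn_integral_cong) (auto simp: Suc.IH[of _ "\<lambda>i. x (Suc i)"])
    also have "\<dots> = ennreal (pmf (K s) (x (Suc 0)) * ?p)"
      by (subst nn_integral_cmult) (simp_all add: emeasure_pmf_single ennreal_mult p0 mult.commute)
    finally have "(\<integral>\<^sup>+ t. emeasure (chain_measure K t) {\<omega>. \<forall>i\<le>n. \<omega> !! i = x (Suc i)}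
        \<partial>measure_pmf (K s)) = ennreal (pmf (K s) (x (Suc 0)) * ?p)" .
    then show ?case
      by (simp add: emeasure_chain_measure[OF meas] shift[simplified] prod.lessThan_Suc_shift
          del: prod.lessThan_Suc)
  qed
  then show ?thesis
    by (simp add: measure_def prod_nonneg)
qed


section \<open>Side-out scoring\<close>

datatype server = A1 | A2 | B1 | B2

datatype state = In_Play nat nat server | A_Wins | B_Wins

instance server :: countable by countable_datatype
instance state :: countable by countable_datatype

definition scores :: "nat \<Rightarrow> (nat \<times> nat) set" where
  "scores n = {..<n} \<times> {..<n} \<union> {(n - 1, n), (n, n - 1)}"

definition states :: "nat \<Rightarrow> state set" where
  "states n = {In_Play i j k | i j k. (i, j) \<in> scores n} \<union> {A_Wins, B_Wins}"

text \<open>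
  The last cases, a win, apply at \<open>(n, n - 1)\<close> and at \<open>(n - 1, n)\<close> respectively. Scores outside
  \<open>scores n\<close> are never reached, see \<open>transition_in_states\<close>.
\<close>

definition point_A :: "nat \<Rightarrow> nat \<Rightarrow> nat \<Rightarrow> server \<Rightarrow> state" where
  "point_A n i j k =
    (if i + 2 \<le> n then In_Play (i + 1) j k
     else if i = n - 1 \<and> j + 2 \<le> n then A_Wins
     else if (i, j) = (n - 1, n - 1) then In_Play n (n - 1) k
     else if (i, j) = (n - 1, n) then In_Play (n - 1) (n - 1) k
     else A_Wins)"

definition point_B :: "nat \<Rightarrow> nat \<Rightarrow> nat \<Rightarrow> server \<Rightarrow> state" where
  "point_B n i j k =
    (if j + 2 \<le> n then In_Play i (j + 1) k
     else if j = n - 1 \<and> i + 2 \<le> n then B_Wins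
     else if (i, j) = (n - 1, n - 1) then In_Play (n - 1) n k
     else if (i, j) = (n, n - 1) then In_Play (n - 1) (n - 1) k
     else B_Wins)"

fun next_server :: "server \<Rightarrow> server" where
  "next_server A1 = A2"
| "next_server A2 = B1"
| "next_server B1 = B2"
| "next_server B2 = A1"

text \<open>
  \<open>bernoulli_pmf p\<close> has the intended meaning for \<open>p\<close> in \<open>[0, 1]\<close>; \<open>True\<close> means that the serving
  team wins the rally.
\<close>

fun transition :: "nat \<Rightarrow> real \<Rightarrow> real \<Rightarrow> state \<Rightarrow> state pmf" where
  "transition n pA pB (In_Play i j k) =
    (if k \<in> {A1, A2}
     then map_pmf (\<lambda>won. if won then point_A n i j k else In_Play i j (next_server k))
            (bernoulli_pmf pA)
     else map_pmf (\<lambda>won. if won then point_B n i j k else In_Play i j (next_server k))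
            (bernoulli_pmf pB))"
| "transition n pA pB A_Wins = return_pmf A_Wins"
| "transition n pA pB B_Wins = return_pmf B_Wins"

definition prob_A_wins :: "nat \<Rightarrow> real \<Rightarrow> real \<Rightarrow> state \<Rightarrow> real" where
  "prob_A_wins n pA pB s =
     measure (chain_measure (transition n pA pB) s) {\<omega>. \<exists>t. \<omega> !! t = A_Wins}"

definition first_serve_advantage :: "nat \<Rightarrow> real \<Rightarrow> real \<Rightarrow> real" where
  "first_serve_advantage n pA pB =
     prob_A_wins n pA pB (In_Play 0 0 A2) - prob_A_wins n pA pB (In_Play 0 0 B2)"

lemma transition_in_states:
  assumes "n \<ge> 1" "s \<in> states n"
  shows "set_pmf (transition n pA pB s) \<subseteq> states n"
proof (cases s)
  case (In_Play i j k)
  then have "(i, j) \<in> scores n" using assms(2) by (auto simp: states_def)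
  then have "point_A n i j k \<in> states n" "point_B n i j k \<in> states n"
    "In_Play i j l \<in> states n" for l
    using assms(1) by (auto simp: states_def scores_def point_A_def point_B_def)
  then show ?thesis by (auto simp: In_Play)
qed (auto simp: states_def)

lemma card_states:
  assumes "n \<ge> 1"
  shows "card (states n - {A_Wins, B_Wins}) = 4 * n\<^sup>2 + 8"
proof -
  have U: "UNIV = {A1, A2, B1, B2}"
    using server.exhaust by auto
  have S: "card (scores n) = n\<^sup>2 + 2"
  proof -
    have "{..<n} \<times> {..<n} \<inter> {(n - 1, n), (n, n - 1)} = {}" "(n - 1, n) \<noteq> (n, n - 1)"
      using assms by auto
    then show ?thesis
      unfolding scores_def
      by (subst card_Un_disjoint) (auto simp: power2_eq_square)
  qed
  have "states n - {A_Wins, B_Wins} = (\<lambda>((i, j), k). In_Play i j k) ` (scores n \<times> UNIV)"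
    by (force simp: states_def image_iff)
  moreover have "inj_on (\<lambda>((i, j), k). In_Play i j k) (scores n \<times> UNIV)"
    by (auto simp: inj_on_def)
  ultimately have "card (states n - {A_Wins, B_Wins}) = card (scores n) * card (UNIV :: server set)"
    by (simp add: card_image card_cartesian_product)
  then show ?thesis by (simp add: S U)
qed

end

(*
  Idea. Compare the expected number of visits to each state when A serves first and when B serves
  first. In the generating function in U = pA u, V = pB v of the visits, the difference of the two
  has the denominator (1 - U)(1 - V) + s with s = qA qB, because
  (1 - G)/(1 - G^2) = 1/(1 + G) when G is the generating function of the points made by one server
  of each team. Its coefficients are the sums
  sum_l C(i,l) C(j,l) (-s)^l, up to powers of 1 + s, pA and pB. Weighting the balance equations of the
  winning probabilities with them telescopes everything except the boundary where a team is at
  n points, and leaves only the twelve deuce states, a linear system solved by hand. The sign of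
  the advantage is therefore that of an explicit polynomial in s and t = qA + qB, linear in t.

  On the diagonal it is a polynomial of degree 32 in q = 1 - x. Its roots are isolated by 14 rational
  intervals on which, alternately, the polynomial or its derivative has no zero; each such claim is
  certified by a Taylor shift with integer coefficients and a Horner-type lower bound. Off the
  diagonal put r = sqrt s and t = 2 r + d with d = (sqrt qA - sqrt qB)^2. Inside the square d is
  quadratically small at the corner where its coefficient is negative, while the diagonal part
  grows linearly there.
*)

theory Submission
  imports Defs
begin

section \<open>Certified bounds for integer polynomials\<close>

definition horner :: "int list \<Rightarrow> real \<Rightarrow> real" where
  "horner cs x = horner_sum of_int x cs"

lemma horner_simps [simp]:
  "horner [] x = 0"
  "horner (c # cs) x = of_int c + x * horner cs x"
  by (simp_all add: horner_def)

fun padd :: "int list \<Rightarrow> int list \<Rightarrow> int list" where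
  "padd [] ds = ds"
| "padd cs [] = cs"
| "padd (c # cs) (d # ds) = (c + d) # padd cs ds"

lemma horner_padd [simp]: "horner (padd cs ds) x = horner cs x + horner ds x"
  by (induction cs ds rule: padd.induct) (auto simp: algebra_simps)

definition pscale :: "int \<Rightarrow> int list \<Rightarrow> int list" where
  "pscale a = map (\<lambda>c. a * c)"

lemma horner_pscale [simp]: "horner (pscale a cs) x = of_int a * horner cs x"
  by (induction cs) (auto simp: pscale_def algebra_simps)

fun pmul :: "int list \<Rightarrow> int list \<Rightarrow> int list" where
  "pmul [] ds = []"
| "pmul (c # cs) ds = padd (pscale c ds) (0 # pmul cs ds)"

lemma horner_pmul [simp]: "horner (pmul cs ds) x = horner cs x * horner ds x"
  by (induction cs) (auto simp: algebra_simps)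

fun pderiv_list :: "int list \<Rightarrow> int list" where
  "pderiv_list [] = []"
| "pderiv_list (c # cs) = padd cs (0 # pderiv_list cs)"

lemma has_real_derivative_horner:
  "(horner cs has_real_derivative horner (pderiv_list cs) x) (at x)"
proof (induction cs)
  case (Cons c cs)
  have "((\<lambda>x. of_int c + x * horner cs x) has_real_derivative
      0 + (1 * horner cs x + horner (pderiv_list cs) x * x)) (at x)"
    by (intro DERIV_add DERIV_mult DERIV_const DERIV_ident Cons.IH)
  moreover have "(\<lambda>x. of_int c + x * horner cs x) = horner (c # cs)"
    by (simp add: fun_eq_iff)
  ultimately show ?case
    by (simp add: mult.commute)
qed (simp add: horner_def)

text \<open>Coefficients in \<open>y\<close> of the polynomial at \<open>(a + y) / m\<close>,
  multiplied by \<open>m\<close> to the power of its formal degree. Clearing denominators this way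
  keeps every certificate in integer arithmetic, which \<open>code_simp\<close> can
  evaluate.\<close>

fun taylor :: "int \<Rightarrow> int \<Rightarrow> int list \<Rightarrow> int list" where
  "taylor a m [] = []"
| "taylor a m (c # cs) =
    (let ds = taylor a m cs in padd (m ^ length cs * c # ds) (pscale a ds))"

lemma horner_taylor:
  assumes "of_int m * x = of_int a + y"
  shows "of_int m ^ (length cs - 1) * horner cs x = horner (taylor a m cs) y"
proof (induction cs)
  case (Cons c cs)
  show ?case
  proof (cases cs)
    case Nil
    then show ?thesis by simp
  next
    case (Cons d ds)
    then have "of_int m ^ length cs * (x * horner cs x)
        = (of_int m * x) * (of_int m ^ (length cs - 1) * horner cs x)" by simp
    then have "of_int m ^ length cs * (x * horner cs x) = (of_int a + y) * horner (taylor a m cs) y"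
      by (simp only: assms Cons.IH)
    then show ?thesis
      by (simp add: Let_def distrib_left distrib_right)
  qed
qed simp

fun horner_bound :: "int \<Rightarrow> int list \<Rightarrow> int" where
  "horner_bound h [] = 0"
| "horner_bound h (c # cs) = c + h * min 0 (horner_bound h cs)"

text \<open>Induction along the Horner scheme: if \<open>b\<close> bounds the tail from below, then
  \<open>y\<close> times the tail is at least \<open>h * min 0 b\<close>. A positive bound on the
  tail is replaced by 0, since \<open>y\<close> may be 0.\<close>

lemma horner_bound_le:
  assumes "0 \<le> y" "y \<le> of_int h"
  shows "of_int (horner_bound h cs) \<le> horner cs y"
proof (induction cs)
  case (Cons c cs)
  let ?b = "horner_bound h cs"
  have "of_int h * min 0 (of_int ?b) \<le> y * min 0 (of_int ?b :: real)"
    using assms by (intro mult_right_mono_neg) auto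
  also have "\<dots> \<le> y * horner cs y"
    using assms Cons.IH by (intro mult_left_mono) auto
  finally show ?case by (simp add: of_int_min)
qed simp

lemma horner_pos:
  assumes "0 < m" "0 < horner_bound h (taylor a m cs)"
    and "of_int a \<le> of_int m * x" "of_int m * x \<le> of_int (a + h)"
  shows "0 < horner cs x"
proof -
  have "(0 :: real) < of_int (horner_bound h (taylor a m cs))"
    using assms(2) by simp
  also have "\<dots> \<le> horner (taylor a m cs) (of_int m * x - of_int a)"
    using assms by (intro horner_bound_le) auto
  also have "\<dots> = of_int m ^ (length cs - 1) * horner cs x"
    by (rule horner_taylor[symmetric]) simp
  finally show ?thesis
    using assms(1) by (simp add: zero_less_mult_iff)
qed

lemma horner_ge:
  assumes "0 < m" "k * m ^ (length cs - 1) \<le> horner_bound h (taylor a m cs)"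
    and "of_int a \<le> of_int m * x" "of_int m * x \<le> of_int (a + h)"
  shows "of_int k \<le> horner cs x"
proof -
  have "of_int (horner_bound h (taylor a m cs)) \<le> horner (taylor a m cs) (of_int m * x - of_int a)"
    using assms by (intro horner_bound_le) auto
  also have "\<dots> = of_int m ^ (length cs - 1) * horner cs x"
    by (rule horner_taylor[symmetric]) simp
  finally have "of_int (k * m ^ (length cs - 1)) \<le> of_int m ^ (length cs - 1) * horner cs x"
    using assms(2) by (meson of_int_le_iff order_trans)
  then show ?thesis
    using assms(1) by (simp add: mult.commute)
qed

fun horner_numerator :: "int \<Rightarrow> int \<Rightarrow> int list \<Rightarrow> int" where
  "horner_numerator a m [] = 0"
| "horner_numerator a m (c # cs) = m ^ length cs * c + a * horner_numerator a m cs"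

lemma horner_horner_numerator:
  assumes "of_int m * x = of_int a"
  shows "of_int m ^ (length cs - 1) * horner cs x = of_int (horner_numerator a m cs)"
proof (induction cs)
  case (Cons c cs)
  show ?case
  proof (cases cs)
    case Nil
    then show ?thesis by simp
  next
    case (Cons d ds)
    then have "of_int m ^ length cs * (x * horner cs x)
        = (of_int m * x) * (of_int m ^ (length cs - 1) * horner cs x)" by simp
    then have "of_int m ^ length cs * (x * horner cs x) = of_int a * of_int (horner_numerator a m cs)"
      by (simp only: assms Cons.IH)
    then show ?thesis
      by (simp add: distrib_left)
  qed
qed simp

text \<open>Two nested intervals have different tasks: the sign change on the narrow one from
  \<open>lo\<close> to \<open>hi\<close> locates the root, and monotonicity on the wide one from
  \<open>l\<close> to \<open>u\<close> gives the signs on both sides of it.\<close>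

lemma increasing_root:
  fixes f f' :: "real \<Rightarrow> real"
  assumes "\<And>x. (f has_real_derivative f' x) (at x)"
    and "\<And>x. x \<in> {l..u} \<Longrightarrow> 0 < f' x"
    and "l \<le> lo" "lo < hi" "hi \<le> u" "f lo < 0" "0 < f hi"
  obtains r where "lo < r" "r < hi" "f r = 0"
    "\<And>x. x \<in> {l..<r} \<Longrightarrow> f x < 0" "\<And>x. x \<in> {r<..u} \<Longrightarrow> 0 < f x"
proof -
  have mono: "f x < f y" if "l \<le> x" "x < y" "y \<le> u" for x y
  proof (rule DERIV_pos_imp_increasing[OF that(2)])
    fix z assume "x \<le> z" "z \<le> y"
    then have "0 < f' z" using that by (intro assms(2)) simp
    then show "\<exists>d. (f has_real_derivative d) (at z) \<and> 0 < d"
      using assms(1) by blast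
  qed
  have "isCont f x" for x
    by (rule DERIV_isCont[OF assms(1)])
  then have "\<forall>x. lo \<le> x \<and> x \<le> hi \<longrightarrow> isCont f x"
    by blast
  moreover have "f lo \<le> 0" "0 \<le> f hi" "lo \<le> hi"
    using assms(4,6,7) by simp_all
  ultimately obtain r where r: "lo \<le> r" "r \<le> hi" "f r = 0"
    using IVT[of f lo 0 hi] by blast
  have "r \<noteq> lo" "r \<noteq> hi"
    using r(3) assms(6,7) by force+
  then have "lo < r" "r < hi"
    using r by simp_all
  moreover have "f x < 0" if "x \<in> {l..<r}" for x
    using mono[of x r] that r \<open>r < hi\<close> assms(5) by simp
  moreover have "0 < f x" if "x \<in> {r<..u}" for x
    using mono[of r x] that r \<open>lo < r\<close> assms(3) by simp
  ultimately show ?thesis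
    using that r(3) by blast
qed

lemma horner_increasing_root:
  assumes "0 < m" "0 < horner_bound h (taylor a m (pderiv_list cs))"
    and "0 < M" "horner_numerator (c - 1) M cs < 0" "0 < horner_numerator (c + 1) M cs"
    and "a * M \<le> (c - 1) * m" "(c + 1) * m \<le> (a + h) * M"
  obtains r where "of_int c - 1 < of_int M * r" "of_int M * r < of_int c + 1" "horner cs r = 0"
    "\<And>x. of_int a / of_int m \<le> x \<Longrightarrow> x < r \<Longrightarrow> horner cs x < 0"
    "\<And>x. r < x \<Longrightarrow> x \<le> of_int (a + h) / of_int m \<Longrightarrow> 0 < horner cs x"
proof -
  let ?f' = "horner (pderiv_list cs)"
  let ?lo = "of_int (c - 1) / of_int M :: real" and ?hi = "of_int (c + 1) / of_int M :: real"
  have pos: "0 < ?f' x" if "x \<in> {of_int a / of_int m..of_int (a + h) / of_int m}" for x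
    using that assms(1) by (intro horner_pos[OF assms(1,2)]) (simp_all add: field_simps)
  have e: "of_int M ^ (length cs - 1) * horner cs (of_int d / of_int M) = of_int (horner_numerator d M cs)" for d
    using assms(3) by (intro horner_horner_numerator) simp
  have lo: "horner cs ?lo < 0"
  proof -
    have "of_int M ^ (length cs - 1) * horner cs ?lo < 0"
      using e[of "c - 1"] assms(4) by (simp only: of_int_less_0_iff)
    then show ?thesis
      using assms(3) by (simp add: mult_less_0_iff)
  qed
  have hi: "0 < horner cs ?hi"
  proof -
    have "0 < of_int M ^ (length cs - 1) * horner cs ?hi"
      using e[of "c + 1"] assms(5) by (simp only: of_int_0_less_iff)
    then show ?thesis
      using assms(3) by (simp add: zero_less_mult_iff)
  qed
  have "of_int a * of_int M \<le> (of_int (c - 1) * of_int m :: real)"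
    "of_int (c + 1) * of_int m \<le> (of_int (a + h) * of_int M :: real)"
    using assms(6,7) by (simp_all only: of_int_mult[symmetric] of_int_le_iff)
  then have le: "of_int a / of_int m \<le> ?lo" "?lo < ?hi" "?hi \<le> of_int (a + h) / of_int m"
    using assms(1,3) by (simp_all add: field_simps)
  obtain r where r: "?lo < r" "r < ?hi" "horner cs r = 0"
    "\<And>x. x \<in> {of_int a / of_int m..<r} \<Longrightarrow> horner cs x < 0"
    "\<And>x. x \<in> {r<..of_int (a + h) / of_int m} \<Longrightarrow> 0 < horner cs x"
    using increasing_root[OF has_real_derivative_horner pos le lo hi] by blast
  show ?thesis
  proof (rule that[of r])
    show "of_int c - 1 < of_int M * r" "of_int M * r < of_int c + 1"
      using r(1,2) assms(3) by (simp_all add: field_simps)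
  qed (use r in auto)
qed

text \<open>These are the coefficients of \<open>advantage_sign 15 (q ^ 2) (2 * q)\<close> in
  \<open>q\<close>, as \<open>advantage_sign_15\<close> shows with \<open>d = 0\<close>.\<close>

definition diag_poly :: "int list" where
  "diag_poly = [1, 0, -192, 26, 7530, -1976, -102660, 40586, 565110, -321776, -1107288, 1067066, -494494,
    -1145144, 3680820, -1104246, -1840410, 2944656, -3271840, -1104246, 2821962, -1145144, 440076,
    1067066, -1029210, -321776, 345240, 40586, -44190, -1976, 2116, 26, -27]"

section \<open>Winning probabilities\<close>

lemma measurable_hits [measurable]:
  "{\<omega>. \<exists>t. \<omega> !! t = A_Wins} \<in> sets (stream_space (count_space UNIV))"
proof -
  have "{\<omega> \<in> space (stream_space (count_space UNIV)). \<exists>t. \<omega> !! t = A_Wins}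
      \<in> sets (stream_space (count_space UNIV))"
    by measurable
  then show ?thesis by (simp add: space_stream_space)
qed

lemma sets_chain_measure: "sets (chain_measure K s) = sets (stream_space (count_space UNIV))"
  by (simp add: chain_measure_def)

lemma emeasure_hits:
  "emeasure (chain_measure (transition n pA pB) s) {\<omega>. \<exists>t. \<omega> !! t = A_Wins}
    = ennreal (prob_A_wins n pA pB s)"
proof -
  interpret prob_space "chain_measure (transition n pA pB) s" by (rule prob_space_chain_measure)
  show ?thesis
    unfolding prob_A_wins_def by (rule emeasure_eq_measure)
qed

lemma prob_A_wins_nonneg: "0 \<le> prob_A_wins n pA pB s"
  by (simp add: prob_A_wins_def)

lemma hits_Cons:
  "{\<omega>. s ## \<omega> \<in> {\<omega>. \<exists>t. \<omega> !! t = A_Wins}}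
    = (if s = A_Wins then UNIV else {\<omega>. \<exists>t. \<omega> !! t = A_Wins})"
proof -
  have "(\<exists>t. (s ## \<omega>) !! t = A_Wins) \<longleftrightarrow> s = A_Wins \<or> (\<exists>t. \<omega> !! t = A_Wins)" for \<omega>
  proof -
    have hit: "(\<exists>t. \<omega>' !! t = A_Wins) \<longleftrightarrow> A_Wins \<in> sset \<omega>'" for \<omega>'
      unfolding sset_range by (metis rangeE rangeI)
    show ?thesis
      unfolding hit by auto
  qed
  then show ?thesis by auto
qed

lemma prob_A_wins_A [simp]: "prob_A_wins n pA pB A_Wins = 1"
proof -
  have "emeasure (chain_measure K t) UNIV = 1" for t and K :: "state \<Rightarrow> state pmf"
    using prob_space.emeasure_space_1[OF prob_space_chain_measure[of K t]]
    by (simp add: chain_measure_def space_stream_space)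
  then have "emeasure (chain_measure (transition n pA pB) A_Wins) {\<omega>. \<exists>t. \<omega> !! t = A_Wins} = 1"
    by (subst emeasure_chain_measure) (simp_all only: measurable_hits hits_Cons, simp)
  then show ?thesis
    by (simp add: emeasure_hits)
qed

lemma prob_A_wins_step:
  assumes "s \<noteq> A_Wins"
  shows "ennreal (prob_A_wins n pA pB s)
    = (\<integral>\<^sup>+ t. ennreal (prob_A_wins n pA pB t) \<partial>measure_pmf (transition n pA pB s))"
  using emeasure_chain_measure[OF measurable_hits, of "transition n pA pB" s] assms
  by (simp only: hits_Cons emeasure_hits if_False)

text \<open>At an absorbing state the one-step equation is a tautology, so the value has to come
  from the paths: every cylinder of the constant path has probability 1, hence almost every path
  never leaves \<open>B_Wins\<close>.\<close>

lemma prob_A_wins_B [simp]: "prob_A_wins n pA pB B_Wins = 0"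
proof -
  let ?C = "chain_measure (transition n pA pB) B_Wins"
  interpret prob_space ?C by (rule prob_space_chain_measure)
  have meas: "{\<omega>. \<forall>i\<le>m. \<omega> !! i = B_Wins} \<in> sets ?C" for m
  proof -
    have "{\<omega> \<in> space (stream_space (count_space UNIV)). \<forall>i\<le>m. \<omega> !! i = B_Wins}
        \<in> sets (stream_space (count_space UNIV))"
      by measurable
    then show ?thesis by (simp add: space_stream_space sets_chain_measure)
  qed
  have "AE \<omega> in ?C. \<omega> \<in> {\<omega>. \<forall>i\<le>m. \<omega> !! i = B_Wins}" for m
  proof (rule AE_prob_1)
    show "prob {\<omega>. \<forall>i\<le>m. \<omega> !! i = B_Wins} = 1"
      using chain_measure_cylinder[of "transition n pA pB" B_Wins m "\<lambda>_. B_Wins"] by simp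
  qed
  then have "AE \<omega> in ?C. \<forall>m. \<omega> \<in> {\<omega>. \<forall>i\<le>m. \<omega> !! i = B_Wins}"
    by (simp add: AE_all_countable)
  then have "AE \<omega> in ?C. \<omega> \<notin> {\<omega>. \<exists>t. \<omega> !! t = A_Wins}"
  proof eventually_elim
    case (elim \<omega>)
    then have "\<omega> !! t = B_Wins" for t by blast
    then show ?case by simp
  qed
  then show ?thesis
    unfolding prob_A_wins_def
    by (subst prob_eq_0) (auto simp: sets_chain_measure measurable_hits)
qed

context
  fixes n :: nat and pA pB :: real
  assumes pA: "0 \<le> pA" "pA \<le> 1" and pB: "0 \<le> pB" "pB \<le> 1"
begin

lemma prob_A_wins_serving_A:
  assumes "k \<in> {A1, A2}"
  shows "prob_A_wins n pA pB (In_Play i j k) =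
    pA * prob_A_wins n pA pB (point_A n i j k)
    + (1 - pA) * prob_A_wins n pA pB (In_Play i j (next_server k))"
proof -
  have "ennreal (prob_A_wins n pA pB (In_Play i j k)) =
      ennreal (pA * prob_A_wins n pA pB (point_A n i j k)
    + (1 - pA) * prob_A_wins n pA pB (In_Play i j (next_server k)))"
    using assms pA
    by (subst prob_A_wins_step)
      (simp_all add: nn_integral_map_pmf ennreal_mult prob_A_wins_nonneg ennreal_plus mult.commute
        del: insert_iff)
  then show ?thesis
    using pA by (subst (asm) ennreal_inj) (simp_all add: prob_A_wins_nonneg)
qed

lemma prob_A_wins_serving_B:
  assumes "k \<in> {B1, B2}"
  shows "prob_A_wins n pA pB (In_Play i j k) =
    pB * prob_A_wins n pA pB (point_B n i j k)
    + (1 - pB) * prob_A_wins n pA pB (In_Play i j (next_server k))"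
proof -
  have "k \<notin> {A1, A2}" using assms by auto
  then have "ennreal (prob_A_wins n pA pB (In_Play i j k)) =
      ennreal (pB * prob_A_wins n pA pB (point_B n i j k)
    + (1 - pB) * prob_A_wins n pA pB (In_Play i j (next_server k)))"
    using pB
    by (subst prob_A_wins_step)
      (simp_all add: nn_integral_map_pmf ennreal_mult prob_A_wins_nonneg ennreal_plus mult.commute
        del: insert_iff)
  then show ?thesis
    using pB by (subst (asm) ennreal_inj) (simp_all add: prob_A_wins_nonneg)
qed

end

section \<open>Telescoping with the difference of visits\<close>

text \<open>For \<open>i = j\<close> and \<open>s\<close> different from -1 this is
  \<open>(1 + s) ^ i\<close> times the Legendre polynomial of degree \<open>i\<close> at
  \<open>(1 - s) / (1 + s)\<close>, which explains the name.\<close>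

definition legendre_sum :: "nat \<Rightarrow> nat \<Rightarrow> real \<Rightarrow> real" where
  "legendre_sum i j s = (\<Sum>l\<le>i. real (i choose l) * real (j choose l) * (- s) ^ l)"

lemma legendre_sum_eq:
  assumes "i \<le> k"
  shows "legendre_sum i j s = (\<Sum>l\<le>k. real (i choose l) * real (j choose l) * (- s) ^ l)"
  unfolding legendre_sum_def using assms
  by (intro sum.mono_neutral_left) (auto simp: binomial_eq_0)

lemma legendre_sum_commute: "legendre_sum i j s = legendre_sum j i s"
  by (simp add: legendre_sum_eq[of i "max i j"] legendre_sum_eq[of j "max i j"] mult_ac)

lemma legendre_sum_0 [simp]: "legendre_sum 0 j s = 1" "legendre_sum i 0 s = 1"
  using legendre_sum_commute[of i 0 s] by (simp_all add: legendre_sum_def)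

text \<open>The mixed difference in \<open>i\<close> and \<open>j\<close> of a product of two
  binomials is the product of the differences. By Pascal's rule each difference lowers
  \<open>l\<close> by one, and the index shift in the sum produces the factor
  \<open>- s\<close>.\<close>

lemma legendre_sum_rec:
  "legendre_sum (Suc i) (Suc j) s =
    legendre_sum i (Suc j) s + legendre_sum (Suc i) j s - (1 + s) * legendre_sum i j s"
proof -
  let ?d = "\<lambda>n l. real (Suc n choose l) - real (n choose l)"
  have eq: "legendre_sum m j s = (\<Sum>l\<le>Suc i. real (m choose l) * real (j choose l) * (- s) ^ l)"
    if "m \<le> Suc i" for m j
    using that by (rule legendre_sum_eq)
  have "legendre_sum (Suc i) (Suc j) s - legendre_sum i (Suc j) s
        - legendre_sum (Suc i) j s + legendre_sum i j s
      = (\<Sum>l\<le>Suc i. ?d i l * ?d j l * (- s) ^ l)"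
    unfolding eq[OF order.refl] eq[OF le_SucI[OF order.refl]] sum_subtractf[symmetric] sum.distrib[symmetric]
    by (intro sum.cong) (simp_all add: algebra_simps)
  also have "\<dots> = (\<Sum>l\<le>i. ?d i (Suc l) * ?d j (Suc l) * (- s) ^ Suc l)"
    by (subst sum.atMost_Suc_shift) simp
  also have "\<dots> = - s * legendre_sum i j s"
    unfolding legendre_sum_def sum_distrib_left by (intro sum.cong) simp_all
  finally show ?thesis
    by (simp add: algebra_simps)
qed

text \<open>
  Difference of the expected visits between \<open>A\<close> and \<open>B\<close> serving first, with indices shifted by one
  so that the scores outside the grid have the value 0: at score \<open>(i, j)\<close> and with \<open>V = visits a b\<close>
  it is \<open>- (1 - b) * V (i + 1) (j + 1)\<close> for \<open>A1\<close>, \<open>V (i + 1) (j + 1) - b * V (i + 1) j\<close> for \<open>A2\<close>,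
  and the negatives of the mirror images for \<open>B1\<close>, \<open>B2\<close>.
\<close>

definition visits :: "real \<Rightarrow> real \<Rightarrow> nat \<Rightarrow> nat \<Rightarrow> real" where
  "visits a b i j = (let s = (1 - a) * (1 - b) in
    if i = 0 \<or> j = 0 then 0
    else a ^ (i - 1) * b ^ (j - 1) * legendre_sum (i - 1) (j - 1) s / (1 + s) ^ (i + j - 1))"

lemma visits_0 [simp]: "visits a b 0 j = 0" "visits a b i 0 = 0"
  by (simp_all add: visits_def)

text \<open>With \<open>U = a u\<close>, \<open>V = b v\<close> and
  \<open>s = (1 - a) * (1 - b)\<close>, this says coefficientwise that the generating function of
  the shifted \<open>visits\<close> is the reciprocal of \<open>(1 - U) (1 - V) + s\<close>; the
  \<open>of_bool\<close> term is the constant 1.\<close>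

lemma visits_rec:
  assumes "1 + (1 - a) * (1 - b) \<noteq> 0"
  shows "(1 + (1 - a) * (1 - b)) * visits a b (Suc i) (Suc j) =
    a * visits a b i (Suc j) + b * visits a b (Suc i) j - a * b * visits a b i j
      + of_bool (i = 0 \<and> j = 0)"
proof -
  define s where "s = (1 - a) * (1 - b)"
  have s: "1 + s \<noteq> 0" using assms by (simp add: s_def)
  have *: "(1 + s) * visits a b (Suc i) (Suc j) =
    a * visits a b i (Suc j) + b * visits a b (Suc i) j - a * b * visits a b i j
      + of_bool (i = 0 \<and> j = 0)"
  proof (cases i)
    case 0
    then show ?thesis
      using s by (cases j) (simp_all add: visits_def s_def[symmetric])
  next
    case i: (Suc i')
    show ?thesis
    proof (cases j)
      case 0
      then show ?thesis
        using s i by (simp add: visits_def s_def[symmetric])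
    next
      case j: (Suc j')
      define c R A where "c = 1 + s" and "R = c ^ Suc (i' + j')" and "A = a ^ i' * b ^ j'"
      have v: "visits a b i j = A * legendre_sum i' j' s / R"
        "visits a b i (Suc j) = A * b * legendre_sum i' (Suc j') s / (c * R)"
        "visits a b (Suc i) j = A * a * legendre_sum (Suc i') j' s / (c * R)"
        "visits a b (Suc i) (Suc j) = A * a * b * legendre_sum (Suc i') (Suc j') s / (c * (c * R))"
        by (simp_all add: i j visits_def s_def[symmetric] c_def R_def A_def)
      have "c \<noteq> 0" "R \<noteq> 0" using s by (simp_all add: c_def R_def)
      then show ?thesis
        unfolding v legendre_sum_rec c_def[symmetric] using i by (simp add: field_simps)
    qed
  qed
  then show ?thesis by (simp add: s_def)
qed

text \<open>The functions \<open>W1\<close> to \<open>W4\<close> need to satisfy the balance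
  equations only inside the grid, so their values at index \<open>n\<close> can be chosen freely.
  Summation by parts pushes everything to the two sides where a team has \<open>n\<close>
  points.\<close>

lemma first_serve_telescope:
  fixes a b :: real and W1 W2 W3 W4 :: "nat \<Rightarrow> nat \<Rightarrow> real"
  defines "V \<equiv> visits a b"
  assumes nz: "1 + (1 - a) * (1 - b) \<noteq> 0"
    and W1: "\<And>i j. i < n \<Longrightarrow> j < n \<Longrightarrow> W1 i j = a * W1 (Suc i) j + (1 - a) * W2 i j"
    and W2: "\<And>i j. i < n \<Longrightarrow> j < n \<Longrightarrow> W2 i j = a * W2 (Suc i) j + (1 - a) * W3 i j"
    and W3: "\<And>i j. i < n \<Longrightarrow> j < n \<Longrightarrow> W3 i j = b * W3 i (Suc j) + (1 - b) * W4 i j"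
    and W4: "\<And>i j. i < n \<Longrightarrow> j < n \<Longrightarrow> W4 i j = b * W4 i (Suc j) + (1 - b) * W1 i j"
    and n: "0 < n"
  shows "W2 0 0 - W4 0 0 =
    (\<Sum>j<n. a * ((V n (Suc j) - b * V n j) * W2 n j - (1 - b) * V n (Suc j) * W1 n j))
    - (\<Sum>i<n. b * ((V (Suc i) n - a * V i n) * W4 i n - (1 - a) * V (Suc i) n * W3 i n))"
proof -
  \<comment> \<open>\<open>X\<close> and \<open>Y\<close> are the flows into score \<open>(i, j)\<close> by a point of \<open>A\<close> and of \<open>B\<close>, weighted
    with the winning probabilities.\<close>
  define X where "X i j = a * ((V i (Suc j) - b * V i j) * W2 i j - (1 - b) * V i (Suc j) * W1 i j)" for i j
  define Y where "Y i j = - b * ((V (Suc i) j - a * V i j) * W4 i j - (1 - a) * V (Suc i) j * W3 i j)" for i j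
  have loc: "(X i j - X (Suc i) j) + (Y i j - Y i (Suc j))
      = - of_bool (i = 0 \<and> j = 0) * (W2 0 0 - W4 0 0)"
    if "i < n" "j < n" for i j
  proof -
    have eqs: "a * W1 (Suc i) j = W1 i j - (1 - a) * W2 i j" "a * W2 (Suc i) j = W2 i j - (1 - a) * W3 i j"
      "b * W3 i (Suc j) = W3 i j - (1 - b) * W4 i j" "b * W4 i (Suc j) = W4 i j - (1 - b) * W1 i j"
      using W1[OF that] W2[OF that] W3[OF that] W4[OF that] by linarith+
    have "X (Suc i) j = (V (Suc i) (Suc j) - b * V (Suc i) j) * (a * W2 (Suc i) j)
        - (1 - b) * V (Suc i) (Suc j) * (a * W1 (Suc i) j)"
      "Y i (Suc j) = - (V (Suc i) (Suc j) - a * V i (Suc j)) * (b * W4 i (Suc j))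
        + (1 - a) * V (Suc i) (Suc j) * (b * W3 i (Suc j))"
      by (simp_all add: X_def Y_def algebra_simps)
    \<comment> \<open>The terms with \<open>W1\<close> and \<open>W3\<close> cancel, and the factor
      left in front of \<open>W2 i j - W4 i j\<close> is the defect of the homogeneous recursion for
      \<open>visits\<close>: it is zero except at the starting score.\<close>
    then have "(X i j - X (Suc i) j) + (Y i j - Y i (Suc j))
      = (a * V i (Suc j) + b * V (Suc i) j - a * b * V i j - (1 + (1 - a) * (1 - b)) * V (Suc i) (Suc j))
        * (W2 i j - W4 i j)"
      unfolding eqs X_def[of i j] Y_def[of i j] by algebra
    then show ?thesis
      unfolding V_def visits_rec[OF nz] by (cases "i = 0 \<and> j = 0") auto
  qed
  have "(\<Sum>i<n. \<Sum>j<n. (X i j - X (Suc i) j) + (Y i j - Y i (Suc j)))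
      = (\<Sum>i<n. \<Sum>j<n. - of_bool (i = 0 \<and> j = 0) * (W2 0 0 - W4 0 0))"
    by (intro sum.cong refl loc) simp_all
  also have "\<dots> = (\<Sum>i<n. if i = 0 then - (W2 0 0 - W4 0 0) else 0)"
  proof (intro sum.cong refl)
    fix i
    have "(\<Sum>j<n. - of_bool (i = 0 \<and> j = 0) * (W2 0 0 - W4 0 0))
        = (\<Sum>j<n. if j = 0 then (if i = 0 then - (W2 0 0 - W4 0 0) else 0) else 0)"
      by (intro sum.cong) auto
    then show "(\<Sum>j<n. - of_bool (i = 0 \<and> j = 0) * (W2 0 0 - W4 0 0))
        = (if i = 0 then - (W2 0 0 - W4 0 0) else 0)"
      using n by simp
  qed
  also have "\<dots> = - (W2 0 0 - W4 0 0)"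
    using n by simp
  also have "(\<Sum>i<n. \<Sum>j<n. (X i j - X (Suc i) j) + (Y i j - Y i (Suc j)))
      = (\<Sum>j<n. \<Sum>i<n. X i j - X (Suc i) j) + (\<Sum>i<n. \<Sum>j<n. Y i j - Y i (Suc j))"
    unfolding sum.distrib by (subst (1) sum.swap) simp
  also have "\<dots> = (\<Sum>j<n. X 0 j - X n j) + (\<Sum>i<n. Y i 0 - Y i n)"
    using sum_lessThan_telescope'[of "\<lambda>i. X i j" n for j] by (simp only: sum_lessThan_telescope')
  \<comment> \<open>\<open>X 0 j\<close> and \<open>Y i 0\<close> vanish because
    \<open>visits\<close> is 0 as soon as one index is 0; this is the benefit of shifting the
    indices by one.\<close>
  also have "\<dots> = - (\<Sum>j<n. X n j) - (\<Sum>i<n. Y i n)"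
    by (simp add: X_def Y_def V_def sum_negf)
  finally show ?thesis
    by (simp add: X_def Y_def sum_negf)
qed

text \<open>On the two sides left by the telescoping, the game is already decided except at
  \<open>(n, n - 1)\<close> and \<open>(n - 1, n)\<close>. Hence the deuce states enter only through
  the single number \<open>k\<close>.\<close>

lemma first_serve_advantage_eq:
  fixes a b :: real and n :: nat
  defines "s \<equiv> (1 - a) * (1 - b)" and "w \<equiv> prob_A_wins n a b"
  defines "k \<equiv> a * (1 - w (In_Play n (n - 1) A2)) + b * w (In_Play (n - 1) n B2)"
  assumes a: "0 \<le> a" "a \<le> 1" and b: "0 \<le> b" "b \<le> 1" and n: "2 \<le> n"
  shows "(1 + s) ^ (2 * n - 1) * first_serve_advantage n a b = (a * b) ^ (n - 1) *
    (k * ((1 + s) * legendre_sum (n - 1) (n - 2) s - (1 - s) * legendre_sum (n - 1) (n - 1) s)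
      + a * b * legendre_sum (n - 1) (n - 1) s)"
proof -
  obtain m where m: "n = Suc (Suc m)"
    using n by (metis add_2_eq_Suc le_Suc_ex)
  note serve = prob_A_wins_serving_A[OF a b, of _ n] prob_A_wins_serving_B[OF a b, of _ n]
  have s: "0 \<le> s" using a b by (simp add: s_def)
  define y z where "y = w (In_Play n (n - 1) A2)" and "z = w (In_Play (n - 1) n B2)"
  have y1: "w (In_Play n (n - 1) A1) = a + (1 - a) * y"
    using serve[of A1 n "n - 1"] m by (simp add: w_def y_def point_A_def)
  have z3: "w (In_Play (n - 1) n B1) = (1 - b) * z"
    using serve[of B1 "n - 1" n] m by (simp add: w_def z_def point_B_def)
  \<comment> \<open>Past a score of \<open>n\<close> the telescoping sum needs the value of a game already won or lost.\<close>
  define WA where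
    "WA k i j = (if i < n then w (In_Play i j k) else if j < n - 1 then 1 else w (In_Play n (n - 1) k))"
    for k i j
  define WB where
    "WB k i j = (if j < n then w (In_Play i j k) else if i < n - 1 then 0 else w (In_Play (n - 1) n k))"
    for k i j
  have pA: "w (point_A n i j k) = WA k (Suc i) j" if "i < n" "j < n" for i j k
    using that by (auto simp: point_A_def WA_def w_def)
  have pB: "w (point_B n i j k) = WB k i (Suc j)" if "i < n" "j < n" for i j k
    using that by (auto simp: point_B_def WB_def w_def)
  let ?V = "visits a b"
  have "WA A2 0 0 - WB B2 0 0 =
    (\<Sum>j<n. a * ((?V n (Suc j) - b * ?V n j) * WA A2 n j - (1 - b) * ?V n (Suc j) * WA A1 n j))
    - (\<Sum>i<n. b * ((?V (Suc i) n - a * ?V i n) * WB B2 i n - (1 - a) * ?V (Suc i) n * WB B1 i n))"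
  proof (rule first_serve_telescope)
    fix i j assume ij: "i < n" "j < n"
    show "WA A1 i j = a * WA A1 (Suc i) j + (1 - a) * WA A2 i j"
      using serve(1)[of A1 i j] pA[OF ij, of A1] ij by (simp add: WA_def w_def)
    show "WA A2 i j = a * WA A2 (Suc i) j + (1 - a) * WB B1 i j"
      using serve(1)[of A2 i j] pA[OF ij, of A2] ij by (simp add: WA_def WB_def w_def)
    show "WB B1 i j = b * WB B1 i (Suc j) + (1 - b) * WB B2 i j"
      using serve(2)[of B1 i j] pB[OF ij, of B1] ij by (simp add: WB_def w_def)
    show "WB B2 i j = b * WB B2 i (Suc j) + (1 - b) * WA A1 i j"
      using serve(2)[of B2 i j] pB[OF ij, of B2] ij by (simp add: WA_def WB_def w_def)
  qed (use s n in \<open>auto simp: s_def\<close>)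
  also have "WA A2 0 0 - WB B2 0 0 = first_serve_advantage n a b"
    using n by (simp add: WA_def WB_def first_serve_advantage_def w_def)
  also have "(\<Sum>j<n. a * ((?V n (Suc j) - b * ?V n j) * WA A2 n j - (1 - b) * ?V n (Suc j) * WA A1 n j))
      = a * b * ?V n (n - 1) + a * ((?V n n - b * ?V n (n - 1)) * y - (1 - b) * ?V n n * (a + (1 - a) * y))"
  proof -
    \<comment> \<open>For \<open>j < n - 1\<close> team A has won and both values are 1, so the
      summands telescope. On the other side the corresponding values are 0, and only
      \<open>i = n - 1\<close> contributes.\<close>
    have "(\<Sum>j<Suc m. a * ((?V n (Suc j) - b * ?V n j) * WA A2 n j - (1 - b) * ?V n (Suc j) * WA A1 n j))
        = (\<Sum>j<Suc m. a * b * (?V n (Suc j) - ?V n j))"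
      by (intro sum.cong refl) (simp add: WA_def m algebra_simps)
    also have "\<dots> = a * b * ?V n (Suc m)"
      by (simp only: sum_distrib_left[symmetric] sum_lessThan_telescope visits_0 diff_zero)
    finally show ?thesis
      using y1 by (simp add: m[symmetric] y_def[symmetric] WA_def) (simp add: m y_def)
  qed
  also have "(\<Sum>i<n. b * ((?V (Suc i) n - a * ?V i n) * WB B2 i n - (1 - a) * ?V (Suc i) n * WB B1 i n))
      = b * ((?V n n - a * ?V (n - 1) n) * z - (1 - a) * ?V n n * ((1 - b) * z))"
    using z3 by (simp add: m z_def WB_def)
  finally have f: "first_serve_advantage n a b = a * (b * ?V n (n - 1))
      + a * ((?V n n - b * ?V n (n - 1)) * y - (1 - b) * ?V n n * (a + (1 - a) * y))
      - b * ((?V n n - a * ?V (n - 1) n) * z - (1 - a) * ?V n n * ((1 - b) * z))"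
    by simp
  define E P Q where "E = legendre_sum (n - 1) (n - 2) s" and "P = legendre_sum (n - 1) (n - 1) s"
    and "Q = (a * b) ^ (n - 1)"
  define c v\<^sub>0 v\<^sub>1 v\<^sub>2 where "c = (1 + s) ^ (2 * n - 1)"
    and "v\<^sub>0 = ?V n n" and "v\<^sub>1 = ?V n (n - 1)" and "v\<^sub>2 = ?V (n - 1) n"
  note v_defs = c_def v\<^sub>0_def v\<^sub>1_def v\<^sub>2_def
  \<comment> \<open>\<open>v\<^sub>1\<close> and \<open>v\<^sub>2\<close> have one factor
    \<open>1 + s\<close> less in the denominator than \<open>v\<^sub>0\<close>. The extra
    \<open>b\<close> or \<open>a\<close> completes their powers to the common factor
    \<open>Q\<close>.\<close>
  have v: "c * v\<^sub>0 = Q * P" "c * (b * v\<^sub>1) = Q * ((1 + s) * E)" "c * (a * v\<^sub>2) = Q * ((1 + s) * E)"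
    unfolding v_defs using s legendre_sum_commute[of m "Suc m" s]
    by (simp_all add: m visits_def s_def[symmetric] Q_def P_def E_def power_mult_distrib mult_2)
  have "c * first_serve_advantage n a b = a * (c * (b * v\<^sub>1))
      + a * ((c * v\<^sub>0 - c * (b * v\<^sub>1)) * y - (1 - b) * (c * v\<^sub>0) * (a + (1 - a) * y))
      - b * ((c * v\<^sub>0 - c * (a * v\<^sub>2)) * z - (1 - a) * (c * v\<^sub>0) * ((1 - b) * z))"
    unfolding f v_defs(2-4)[symmetric] by (simp add: algebra_simps)
  then have "c * first_serve_advantage n a b = a * (Q * ((1 + s) * E))
      + a * ((Q * P - Q * ((1 + s) * E)) * y - (1 - b) * (Q * P) * (a + (1 - a) * y))
      - b * ((Q * P - Q * ((1 + s) * E)) * z - (1 - a) * (Q * P) * ((1 - b) * z))"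
    unfolding v .
  also have "\<dots> = Q * (k * ((1 + s) * E - (1 - s) * P) + a * b * P)"
    unfolding k_def y_def[symmetric] z_def[symmetric] s_def by algebra
  finally show ?thesis
    by (simp only: E_def P_def Q_def c_def)
qed

text \<open>The scores \<open>(n - 1, n - 1)\<close>, \<open>(n, n - 1)\<close> and
  \<open>(n - 1, n)\<close> form a closed system, since every point leads back into them or ends the
  game. The equation for \<open>k\<close> is kept free of division; its left factor is seen to be
  positive in \<open>sgn_first_serve_advantage\<close>.\<close>

lemma deuce_advantage:
  fixes a b :: real and n :: nat
  defines "s \<equiv> (1 - a) * (1 - b)" and "t \<equiv> (1 - a) + (1 - b)" and "w \<equiv> prob_A_wins n a b"
  defines "k \<equiv> a * (1 - w (In_Play n (n - 1) A2)) + b * w (In_Play (n - 1) n B2)"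
  assumes a: "0 \<le> a" "a \<le> 1" and b: "0 \<le> b" "b \<le> 1" and n: "1 \<le> n"
  shows "k * (1 + 4 * s + s ^ 2 - 2 * s ^ 3 - t * s * (3 - s)) =
    a * b * (2 * s ^ 2 + 2 * s + t * (1 - s))"
proof -
  note serve = prob_A_wins_serving_A[OF a b, of _ n] prob_A_wins_serving_B[OF a b, of _ n]
  define u v where "u = 1 - a" and "v = 1 - b"
  define w1 w2 w3 w4 where "w1 = w (In_Play (n - 1) (n - 1) A1)" and "w2 = w (In_Play (n - 1) (n - 1) A2)"
    and "w3 = w (In_Play (n - 1) (n - 1) B1)" and "w4 = w (In_Play (n - 1) (n - 1) B2)"
  define y1 y2 y3 y4 where "y1 = w (In_Play n (n - 1) A1)" and "y2 = w (In_Play n (n - 1) A2)"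
    and "y3 = w (In_Play n (n - 1) B1)" and "y4 = w (In_Play n (n - 1) B2)"
  define z1 z2 z3 z4 where "z1 = w (In_Play (n - 1) n A1)" and "z2 = w (In_Play (n - 1) n A2)"
    and "z3 = w (In_Play (n - 1) n B1)" and "z4 = w (In_Play (n - 1) n B2)"
  note defs = w_def w1_def w2_def w3_def w4_def y1_def y2_def y3_def y4_def z1_def z2_def z3_def z4_def u_def v_def
  have W1: "w1 = a * y1 + u * w2"
    using serve(1)[of A1 "n - 1" "n - 1"] n by (simp add: defs point_A_def point_B_def)
  have W2: "w2 = a * y2 + u * w3"
    using serve(1)[of A2 "n - 1" "n - 1"] n by (simp add: defs point_A_def point_B_def)
  have W3: "w3 = b * z3 + v * w4"
    using serve(2)[of B1 "n - 1" "n - 1"] n by (simp add: defs point_A_def point_B_def)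
  have W4: "w4 = b * z4 + v * w1"
    using serve(2)[of B2 "n - 1" "n - 1"] n by (simp add: defs point_A_def point_B_def)
  have Y1: "y1 = a + u * y2"
    using serve(1)[of A1 n "n - 1"] n by (simp add: defs point_A_def point_B_def)
  have Y2: "y2 = a + u * y3"
    using serve(1)[of A2 n "n - 1"] n by (simp add: defs point_A_def point_B_def)
  have Y3: "y3 = b * w3 + v * y4"
    using serve(2)[of B1 n "n - 1"] n by (simp add: defs point_A_def point_B_def)
  have Y4: "y4 = b * w4 + v * y1"
    using serve(2)[of B2 n "n - 1"] n by (simp add: defs point_A_def point_B_def)
  have Z1: "z1 = a * w1 + u * z2"
    using serve(1)[of A1 "n - 1" n] n by (simp add: defs point_A_def point_B_def)
  have Z2: "z2 = a * w2 + u * z3"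
    using serve(1)[of A2 "n - 1" n] n by (simp add: defs point_A_def point_B_def)
  have Z3: "z3 = v * z4"
    using serve(2)[of B1 "n - 1" n] n by (simp add: defs point_A_def point_B_def)
  have Z4: "z4 = v * z1"
    using serve(2)[of B2 "n - 1" n] n by (simp add: defs point_A_def point_B_def)
  have ab: "a = 1 - u" "b = 1 - v" by (simp_all add: u_def v_def)
  \<comment> \<open>Following the service through one full cycle at an unequal score returns to the
    same unknown with factor \<open>(u * v) ^ 2\<close>. This eliminates the other states at these
    scores and leaves six unknowns: \<open>y2\<close>, \<open>z4\<close> and \<open>w1\<close> to
    \<open>w4\<close>.\<close>
  define e1 e2 where "e1 = (1 - (u * v) ^ 2) * y2 - (a + u * b * w3 + u * v * b * w4 + u * v * v * a)"
    and "e2 = (1 - (u * v) ^ 2) * z4 - (v * a * w1 + u * v * a * w2)"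
  define e3 e4 e5 e6 where "e3 = w1 - (a * (a + u * y2) + u * w2)" and "e4 = w2 - (a * y2 + u * w3)"
    and "e5 = w3 - (b * (v * z4) + v * w4)" and "e6 = w4 - (b * z4 + v * w1)"
  have "e1 = 0" "e2 = 0"
    unfolding e1_def e2_def using Y2[unfolded Y3 Y4 Y1] Z4[unfolded Z1 Z2 Z3]
    by algebra+
  have e: "e1 = 0" "e2 = 0" "e3 = 0" "e4 = 0" "e5 = 0" "e6 = 0"
    using \<open>e1 = 0\<close> \<open>e2 = 0\<close> W1[unfolded Y1] W2 W3[unfolded Z3] W4
    unfolding e3_def e4_def e5_def e6_def by linarith+
  \<comment> \<open>The multipliers are the cofactors of the \<open>6 \<times> 6\<close> system, after division by a common factor.\<close>
  have "k * (1 + 4 * s + s ^ 2 - 2 * s ^ 3 - t * s * (3 - s)) - a * b * (2 * s ^ 2 + 2 * s + t * (1 - s))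
    = - a * (1 + u * v) * e1 + b * (1 + u * v) * e2 + a * b * (1 - u * v) * v * e3
      + 2 * a * b * (u * v) * e4 - a * b * (1 - u * v) * u * e5 - 2 * a * b * (u * v) * e6"
    unfolding k_def s_def t_def u_def[symmetric] v_def[symmetric] y2_def[symmetric] z4_def[symmetric]
      e1_def e2_def e3_def e4_def e5_def e6_def ab
    by algebra
  then show ?thesis
    unfolding e by simp
qed

section \<open>The sign polynomial\<close>

definition advantage_sign :: "nat \<Rightarrow> real \<Rightarrow> real \<Rightarrow> real" where
  "advantage_sign n s t = (let E = legendre_sum (n - 1) (n - 2) s; P = legendre_sum (n - 1) (n - 1) s in
    (2 * s ^ 2 + 2 * s + t * (1 - s)) * ((1 + s) * E - (1 - s) * P)
    + (1 + 4 * s + s ^ 2 - 2 * s ^ 3 - t * s * (3 - s)) * P)"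

text \<open>Multiplying \<open>first_serve_advantage_eq\<close> by the factor \<open>D\<close> from
  \<open>deuce_advantage\<close> turns \<open>k * D\<close> into \<open>a * b * N\<close> and
  eliminates \<open>k\<close>. All factors stripped off are positive.\<close>

lemma sgn_first_serve_advantage:
  fixes a b :: real
  assumes a: "0 < a" "a < 1" and b: "0 < b" "b < 1" and n: "2 \<le> n"
  shows "sgn (first_serve_advantage n a b)
    = sgn (advantage_sign n ((1 - a) * (1 - b)) ((1 - a) + (1 - b)))"
proof -
  define s t where "s = (1 - a) * (1 - b)" and "t = (1 - a) + (1 - b)"
  define f E P Q c where "f = first_serve_advantage n a b"
    and "E = legendre_sum (n - 1) (n - 2) s" and "P = legendre_sum (n - 1) (n - 1) s"
    and "Q = (a * b) ^ (n - 1)" and "c = (1 + s) ^ (2 * n - 1)"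
  define D N where "D = 1 + 4 * s + s ^ 2 - 2 * s ^ 3 - t * s * (3 - s)"
    and "N = 2 * s ^ 2 + 2 * s + t * (1 - s)"
  have s: "0 < s" "s < 1"
    using a b mult_strict_mono[of "1 - a" 1 "1 - b" 1] by (simp_all add: s_def)
  obtain k where k: "c * f = Q * (k * ((1 + s) * E - (1 - s) * P) + a * b * P)"
    "k * D = a * b * N"
    using first_serve_advantage_eq[of a b n] deuce_advantage[of a b n] assms
    unfolding s_def t_def f_def E_def P_def Q_def c_def D_def N_def by auto
  \<comment> \<open>\<open>D\<close> has negative terms; grouping them with
    \<open>1 + s - t\<close>, which equals \<open>a * b\<close>, exhibits it as a sum of a
    nonnegative and a positive term.\<close>
  have "D = (1 + s - t) * (s * (3 - s)) + (1 + s) * (1 - s ^ 2)"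
    unfolding D_def by algebra
  moreover have "1 + s - t = a * b"
    unfolding s_def t_def by algebra
  moreover have "0 \<le> a * b * (s * (3 - s))" "0 < (1 + s) * (1 - s ^ 2)"
    using a b s by (simp_all add: power_less_one_iff)
  ultimately have D: "0 < D"
    by simp
  have "c * D * f = D * (c * f)"
    by simp
  also have "\<dots> = Q * ((k * D) * ((1 + s) * E - (1 - s) * P) + a * b * (D * P))"
    unfolding k(1) by algebra
  also have "\<dots> = (Q * a * b) * advantage_sign n s t"
    unfolding k(2) advantage_sign_def Let_def E_def[symmetric] P_def[symmetric] D_def[symmetric]
      N_def[symmetric] by algebra
  finally have "c * D * f = (Q * a * b) * advantage_sign n s t" .
  moreover have "0 < c * D" "0 < Q * a * b"
    using s a b D by (simp_all add: c_def Q_def)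
  ultimately have "sgn f = sgn (advantage_sign n s t)"
    by (metis mult_1 sgn_mult sgn_pos)
  then show ?thesis
    by (simp add: f_def s_def t_def)
qed

section \<open>The sign polynomial for games to 15 as integer coefficient lists\<close>

lemma choose_eqI:
  assumes "k \<le> n" "fact k * fact (n - k) * c = (fact n :: nat)"
  shows "n choose k = c"
proof -
  have "fact k * fact (n - k) * (n choose k) = fact k * fact (n - k) * c"
    using binomial_fact_lemma[OF assms(1)] assms(2) by simp
  then show ?thesis by simp
qed

lemma choose_13:
  "13 choose 2 = (78 :: nat)" "13 choose 3 = (286 :: nat)" "13 choose 4 = (715 :: nat)"
  "13 choose 5 = (1287 :: nat)" "13 choose 6 = (1716 :: nat)" "13 choose 7 = (1716 :: nat)"
  "13 choose 8 = (1287 :: nat)" "13 choose 9 = (715 :: nat)" "13 choose 10 = (286 :: nat)"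
  "13 choose 11 = (78 :: nat)" "13 choose 12 = (13 :: nat)"
  by (rule choose_eqI; simp add: fact_numeral)+
lemma choose_14:
  "14 choose 2 = (91 :: nat)" "14 choose 3 = (364 :: nat)" "14 choose 4 = (1001 :: nat)"
  "14 choose 5 = (2002 :: nat)" "14 choose 6 = (3003 :: nat)" "14 choose 7 = (3432 :: nat)"
  "14 choose 8 = (3003 :: nat)" "14 choose 9 = (2002 :: nat)" "14 choose 10 = (1001 :: nat)"
  "14 choose 11 = (364 :: nat)" "14 choose 12 = (91 :: nat)" "14 choose 13 = (14 :: nat)"
  by (rule choose_eqI; simp add: fact_numeral)+

definition legendre_list :: "nat \<Rightarrow> nat \<Rightarrow> int list" where
  "legendre_list i j = map (\<lambda>l. (- 1) ^ l * int ((i choose l) * (j choose l))) [0..<Suc i]"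

lemma horner_legendre_list: "horner (legendre_list i j) s = legendre_sum i j s"
proof -
  have "horner (legendre_list i j) s = (\<Sum>l<Suc i. of_int (legendre_list i j ! l) * s ^ l)"
    by (simp only: horner_def horner_sum_eq_sum legendre_list_def length_map length_upt diff_zero
        atLeast0LessThan)
  also have "\<dots> = (\<Sum>l<Suc i. real (i choose l) * real (j choose l) * (- s) ^ l)"
  proof (rule sum.cong)
    fix l assume "l \<in> {..<Suc i}"
    then have "legendre_list i j ! l = (- 1) ^ l * int ((i choose l) * (j choose l))"
      by (simp add: legendre_list_def del: upt_Suc)
    then show "of_int (legendre_list i j ! l) * s ^ l = real (i choose l) * real (j choose l) * (- s) ^ l"
      by (simp add: power_minus[of s])
  qed simp
  finally show ?thesis
    by (simp only: legendre_sum_def lessThan_Suc_atMost)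
qed

lemma legendre_list_14:
  "legendre_list 14 13 = [1, -182, 7098, -104104, 715715, -2576574, 5153148, -5889312, 3864861,
    -1431430, 286286, -28392, 1183, -14, 0]"
  "legendre_list 14 14 = [1, -196, 8281, -132496, 1002001, -4008004, 9018009, -11778624, 9018009,
    -4008004, 1002001, -132496, 8281, -196, 1]"
proof -
  have "[0..<Suc 14] = [0, 1, 2, 3, 4, 5, 6, 7, 8, 9, 10, 11, 12, 13, 14]"
    by code_simp
  then show "legendre_list 14 13 = [1, -182, 7098, -104104, 715715, -2576574, 5153148, -5889312, 3864861,
    -1431430, 286286, -28392, 1183, -14, 0]"
  "legendre_list 14 14 = [1, -196, 8281, -132496, 1002001, -4008004, 9018009, -11778624, 9018009,
    -4008004, 1002001, -132496, 8281, -196, 1]"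
    unfolding legendre_list_def by (simp_all only: list.map choose_13 choose_14) simp_all
qed

fun spread :: "int list \<Rightarrow> int list" where
  "spread [] = []"
| "spread (c # cs) = c # 0 # spread cs"

lemma horner_spread [simp]: "horner (spread cs) x = horner cs (x ^ 2)"
  by (induction cs) (auto simp: algebra_simps power2_eq_square)

lemma horner_append_0: "horner (cs @ replicate m 0) x = horner cs x"
proof -
  have "horner (replicate m 0) x = 0"
    by (induction m) simp_all
  then show ?thesis
    by (induction cs) simp_all
qed

text \<open>The combination \<open>(1 + s) * E - (1 - s) * P\<close> from
  \<open>advantage_sign\<close> at \<open>n = 15\<close>, as a polynomial in
  \<open>s\<close>.\<close>

definition legendre_gap_list :: "int list" where
  "legendre_gap_list = padd (pmul [1, 1] (legendre_list 14 13)) (pmul [-1, 1] (legendre_list 14 14))"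

text \<open>The coefficient of \<open>t\<close> in \<open>advantage_sign 15 s t\<close>, as a
  polynomial in \<open>s\<close>.\<close>

definition asym_poly :: "int list" where
  "asym_poly = [0, 13, -988, 20293, -160888, 533533, -572572, -552123, 1472328, -552123, -572572,
    533533, -160888, 20293, -988, 13]"

text \<open>The two short lists are the factors of \<open>advantage_sign\<close> at
  \<open>s = r ^ 2\<close>, \<open>t = 2 * r\<close>. Trailing zeros remain because the two highest
  coefficients cancel and \<open>spread\<close> appends a zero.\<close>

lemma diag_poly_eq:
  "padd (pmul [0, 2, 2, -2, 2] (spread legendre_gap_list))
    (pmul [1, 0, 4, -6, 1, 2, -2] (spread (legendre_list 14 14))) = diag_poly @ replicate 3 0"
  unfolding legendre_gap_list_def legendre_list_14 by code_simp

lemma asym_poly_eq: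
  "padd (pmul [1, -1] legendre_gap_list) (pmul [0, -3, 1] (legendre_list 14 14)) = asym_poly @ replicate 1 0"
  unfolding legendre_gap_list_def legendre_list_14 by code_simp

text \<open>Since \<open>advantage_sign\<close> is linear in \<open>t\<close>, splitting
  \<open>t\<close> into its diagonal value \<open>2 * r\<close> and a deviation \<open>d\<close> is
  exact.\<close>

lemma advantage_sign_15:
  "advantage_sign 15 (r ^ 2) (2 * r + d) = horner diag_poly r + d * horner asym_poly (r ^ 2)"
proof -
  let ?M = "horner legendre_gap_list (r ^ 2)" and ?P = "horner (legendre_list 14 14) (r ^ 2)"
  have M: "?M = (1 + r ^ 2) * legendre_sum 14 13 (r ^ 2) - (1 - r ^ 2) * legendre_sum 14 14 (r ^ 2)"
    by (simp add: legendre_gap_list_def horner_legendre_list algebra_simps)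
  have g: "horner diag_poly r = (2 * r + 2 * r ^ 2 - 2 * r ^ 3 + 2 * r ^ 4) * ?M
      + (1 + 4 * r ^ 2 - 6 * r ^ 3 + r ^ 4 + 2 * r ^ 5 - 2 * r ^ 6) * ?P"
    unfolding horner_append_0[of diag_poly 3, symmetric] diag_poly_eq[symmetric]
      horner_padd horner_pmul horner_spread horner_simps of_int_minus of_int_0 of_int_1 of_int_numeral
    by algebra
  have h: "horner asym_poly (r ^ 2) = (1 - r ^ 2) * ?M + (- 3 * r ^ 2 + r ^ 4) * ?P"
    unfolding horner_append_0[of asym_poly 1, symmetric] asym_poly_eq[symmetric]
      horner_padd horner_pmul horner_simps of_int_minus of_int_0 of_int_1 of_int_numeral by algebra
  have "advantage_sign 15 (r ^ 2) (2 * r + d) =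
    (2 * (r ^ 2) ^ 2 + 2 * r ^ 2 + (2 * r + d) * (1 - r ^ 2)) * ?M
    + (1 + 4 * r ^ 2 + (r ^ 2) ^ 2 - 2 * (r ^ 2) ^ 3 - (2 * r + d) * r ^ 2 * (3 - r ^ 2)) * ?P"
    unfolding advantage_sign_def Let_def M by (simp add: horner_legendre_list)
  then show ?thesis
    unfolding g h by algebra
qed

section \<open>Isolation of the roots of the diagonal polynomial\<close>

lemma diag_sign:
  assumes "0 < horner_bound h (taylor a 64 (pscale \<sigma> diag_poly))"
    and "of_int a / 64 \<le> x" "x \<le> of_int (a + h) / 64"
  shows "0 < of_int \<sigma> * horner diag_poly x"
  using horner_pos[OF _ assms(1), of x] assms(2,3) by simp

text \<open>The factor \<open>\<sigma>\<close>, 1 or -1 in the applications, reduces decreasing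
  crossings to increasing ones. The denominator 2000000 is twice \<open>10 ^ 6\<close>, so the
  bracket from \<open>c - 1\<close> to \<open>c + 1\<close> is exactly a rounding interval for six
  decimals when \<open>c\<close> is even.\<close>

lemma diag_root:
  assumes "0 < horner_bound h (taylor a 64 (pderiv_list (pscale \<sigma> diag_poly)))"
    and "horner_numerator (c - 1) 2000000 (pscale \<sigma> diag_poly) < 0" "0 < horner_numerator (c + 1) 2000000 (pscale \<sigma> diag_poly)"
    and "a * 2000000 \<le> (c - 1) * 64" "(c + 1) * 64 \<le> (a + h) * 2000000" and "\<sigma> \<noteq> 0"
  obtains r where "of_int c - 1 < 2000000 * r" "2000000 * r < of_int c + 1" "horner diag_poly r = 0"
    "\<And>x. of_int a / 64 \<le> x \<Longrightarrow> x < r \<Longrightarrow> of_int \<sigma> * horner diag_poly x < 0"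
    "\<And>x. r < x \<Longrightarrow> x \<le> of_int (a + h) / 64 \<Longrightarrow> 0 < of_int \<sigma> * horner diag_poly x"
  using horner_increasing_root[of 64 h a "pscale \<sigma> diag_poly" 2000000 c, OF _ assms(1) _ assms(2-5)] assms(6)
  by auto

lemma diag_root_1:
  obtains r where "167251 < 2000000 * r" "2000000 * r < 167253" "horner diag_poly r = 0"
    "\<And>x. 4 / 64 \<le> x \<Longrightarrow> x < r \<Longrightarrow> 0 < horner diag_poly x"
    "\<And>x. r < x \<Longrightarrow> x \<le> 8 / 64 \<Longrightarrow> horner diag_poly x < 0"
proof (rule diag_root[of 4 4 "-1" 167252])
  show "0 < horner_bound 4 (taylor 4 64 (pderiv_list (pscale (-1) diag_poly)))"
    by code_simp
  show "horner_numerator (167252 - 1) 2000000 (pscale (-1) diag_poly) < 0"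
    by code_simp
  show "0 < horner_numerator (167252 + 1) 2000000 (pscale (-1) diag_poly)"
    by code_simp
qed (use that in simp_all)

lemma diag_root_2:
  obtains r where "391083 < 2000000 * r" "2000000 * r < 391085" "horner diag_poly r = 0"
    "\<And>x. 12 / 64 \<le> x \<Longrightarrow> x < r \<Longrightarrow> horner diag_poly x < 0"
    "\<And>x. r < x \<Longrightarrow> x \<le> 16 / 64 \<Longrightarrow> 0 < horner diag_poly x"
proof (rule diag_root[of 4 12 "1" 391084])
  show "0 < horner_bound 4 (taylor 12 64 (pderiv_list (pscale (1) diag_poly)))"
    by code_simp
  show "horner_numerator (391084 - 1) 2000000 (pscale (1) diag_poly) < 0"
    by code_simp
  show "0 < horner_numerator (391084 + 1) 2000000 (pscale (1) diag_poly)"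
    by code_simp
qed (use that in simp_all)

lemma diag_root_3:
  obtains r where "629599 < 2000000 * r" "2000000 * r < 629601" "horner diag_poly r = 0"
    "\<And>x. 19 / 64 \<le> x \<Longrightarrow> x < r \<Longrightarrow> 0 < horner diag_poly x"
    "\<And>x. r < x \<Longrightarrow> x \<le> 24 / 64 \<Longrightarrow> horner diag_poly x < 0"
proof (rule diag_root[of 5 19 "-1" 629600])
  show "0 < horner_bound 5 (taylor 19 64 (pderiv_list (pscale (-1) diag_poly)))"
    by code_simp
  show "horner_numerator (629600 - 1) 2000000 (pscale (-1) diag_poly) < 0"
    by code_simp
  show "0 < horner_numerator (629600 + 1) 2000000 (pscale (-1) diag_poly)"
    by code_simp
qed (use that in simp_all)

lemma diag_root_4:
  obtains r where "888431 < 2000000 * r" "2000000 * r < 888433" "horner diag_poly r = 0"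
    "\<And>x. 28 / 64 \<le> x \<Longrightarrow> x < r \<Longrightarrow> horner diag_poly x < 0"
    "\<And>x. r < x \<Longrightarrow> x \<le> 34 / 64 \<Longrightarrow> 0 < horner diag_poly x"
proof (rule diag_root[of 6 28 "1" 888432])
  show "0 < horner_bound 6 (taylor 28 64 (pderiv_list (pscale (1) diag_poly)))"
    by code_simp
  show "horner_numerator (888432 - 1) 2000000 (pscale (1) diag_poly) < 0"
    by code_simp
  show "0 < horner_numerator (888432 + 1) 2000000 (pscale (1) diag_poly)"
    by code_simp
qed (use that in simp_all)

lemma diag_root_5:
  obtains r where "1176115 < 2000000 * r" "2000000 * r < 1176117" "horner diag_poly r = 0"
    "\<And>x. 37 / 64 \<le> x \<Longrightarrow> x < r \<Longrightarrow> 0 < horner diag_poly x"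
    "\<And>x. r < x \<Longrightarrow> x \<le> 44 / 64 \<Longrightarrow> horner diag_poly x < 0"
proof (rule diag_root[of 7 37 "-1" 1176116])
  show "0 < horner_bound 7 (taylor 37 64 (pderiv_list (pscale (-1) diag_poly)))"
    by code_simp
  show "horner_numerator (1176116 - 1) 2000000 (pscale (-1) diag_poly) < 0"
    by code_simp
  show "0 < horner_numerator (1176116 + 1) 2000000 (pscale (-1) diag_poly)"
    by code_simp
qed (use that in simp_all)

lemma diag_root_6:
  obtains r where "1504869 < 2000000 * r" "2000000 * r < 1504871" "horner diag_poly r = 0"
    "\<And>x. 48 / 64 \<le> x \<Longrightarrow> x < r \<Longrightarrow> horner diag_poly x < 0"
    "\<And>x. r < x \<Longrightarrow> x \<le> 57 / 64 \<Longrightarrow> 0 < horner diag_poly x"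
proof (rule diag_root[of 9 48 "1" 1504870])
  show "0 < horner_bound 9 (taylor 48 64 (pderiv_list (pscale (1) diag_poly)))"
    by code_simp
  show "horner_numerator (1504870 - 1) 2000000 (pscale (1) diag_poly) < 0"
    by code_simp
  show "0 < horner_numerator (1504870 + 1) 2000000 (pscale (1) diag_poly)"
    by code_simp
qed (use that in simp_all)

lemma diag_root_7:
  obtains r where "1893083 < 2000000 * r" "2000000 * r < 1893085" "horner diag_poly r = 0"
    "\<And>x. 60 / 64 \<le> x \<Longrightarrow> x < r \<Longrightarrow> 0 < horner diag_poly x"
    "\<And>x. r < x \<Longrightarrow> x \<le> 64 / 64 \<Longrightarrow> horner diag_poly x < 0"
proof (rule diag_root[of 4 60 "-1" 1893084])
  show "0 < horner_bound 4 (taylor 60 64 (pderiv_list (pscale (-1) diag_poly)))"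
    by code_simp
  show "horner_numerator (1893084 - 1) 2000000 (pscale (-1) diag_poly) < 0"
    by code_simp
  show "0 < horner_numerator (1893084 + 1) 2000000 (pscale (-1) diag_poly)"
    by code_simp
qed (use that in simp_all)

text \<open>The delicate corner is \<open>u = v = l\<close>, where the diagonal part vanishes and
  the coefficient of \<open>d\<close> may be negative. There \<open>d\<close> is at most
  \<open>(r - l) ^ 2 / l\<close>, while the diagonal part is at least a multiple of
  \<open>r - l\<close>.\<close>

lemma advantage_sign_square_pos:
  fixes l m u v :: real
  assumes l: "horner diag_poly l = 0" "888431 / 2000000 < l" and m: "m < 1176119 / 2000000"
    and pos: "\<And>r. l < r \<Longrightarrow> r < m \<Longrightarrow> 0 < horner diag_poly r"
    and uv: "l < u" "u < m" "l < v" "v < m"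
  shows "0 < advantage_sign 15 (u * v) (u + v)"
proof -
  define p q r d where "p = sqrt u" and "q = sqrt v" and "r = p * q" and "d = (p - q) ^ 2"
  have pq: "u = p ^ 2" "v = q ^ 2" "0 \<le> p" "0 \<le> q"
    using l uv by (simp_all add: p_def q_def)
  have r2: "r ^ 2 = u * v" and t: "2 * r + d = u + v"
    by (simp_all add: r_def d_def pq power2_eq_square algebra_simps)
  have "0 \<le> r" using pq by (simp add: r_def)
  have "l * l < u * v" "u * v < m * m"
    using l uv by (auto intro!: mult_strict_mono)
  then have "l ^ 2 < r ^ 2" "r ^ 2 < m ^ 2"
    unfolding r2 by (simp_all only: power2_eq_square)
  then have r: "l < r" "r < m"
    using \<open>0 \<le> r\<close> l uv by (auto intro: power2_less_imp_less)
  define k where "k = sqrt l"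
  have k: "l = k ^ 2" "0 \<le> k" "k \<le> p" "k \<le> q"
    using l uv by (simp_all add: k_def p_def q_def)
  \<comment> \<open>The two products expand to \<open>r - l + k * (p - q)\<close> and
    \<open>r - l - k * (p - q)\<close>. Squaring the result gives the bound on
    \<open>d\<close>.\<close>
  have "\<bar>k * (p - q)\<bar> \<le> r - l"
  proof -
    have "0 \<le> (p - k) * (q + k)" "0 \<le> (p + k) * (q - k)"
      using k pq by simp_all
    then show ?thesis
      by (simp add: r_def k(1) algebra_simps power2_eq_square abs_le_iff)
  qed
  then have "(k * (p - q)) ^ 2 \<le> (r - l) ^ 2"
    by (rule abs_le_square_iff[THEN iffD1, OF order.trans]) simp
  then have d: "l * d \<le> (r - l) ^ 2" "0 \<le> d"
    by (simp_all add: d_def k(1) power_mult_distrib)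
  \<comment> \<open>Certified for arguments in \<open>[6/32, 11/32]\<close>, which contains
    \<open>r ^ 2\<close> for all \<open>r\<close> considered here.\<close>
  have low: "- 9 \<le> horner asym_poly (r ^ 2)" if "r \<le> 37 / 64"
  proof -
    have "(- 9 :: int) * 32 ^ (length asym_poly - 1) \<le> horner_bound 5 (taylor 6 32 asym_poly)"
      by code_simp
    moreover have "(888431 / 2000000) ^ 2 < r ^ 2" "r ^ 2 \<le> (37 / 64) ^ 2"
      using that r l by (auto intro!: power_strict_mono power_mono)
    ultimately show ?thesis
      using horner_ge[of 32 "- 9" asym_poly 5 6 "r ^ 2"] by (simp add: power2_eq_square)
  qed
  have "0 < horner diag_poly r + d * horner asym_poly (r ^ 2)"
  proof -
    \<comment> \<open>Near \<open>l\<close> the slope of the diagonal part is at least 10 and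
      outweighs \<open>9 * d\<close>. In the middle the diagonal part is at least 1 and
      \<open>9 * d\<close> is below 1. Beyond \<open>37 / 64\<close> the coefficient of
      \<open>d\<close> is itself positive.\<close>
    consider "r \<le> 34 / 64" | "34 / 64 < r" "r \<le> 37 / 64" | "37 / 64 < r" by linarith
    then show ?thesis
    proof cases
      case 1
      have cert: "10 * 64 ^ (length (pderiv_list diag_poly) - 1)
          \<le> horner_bound 6 (taylor 28 64 (pderiv_list diag_poly))"
        by code_simp
      obtain z where z: "l < z" "z < r"
        "horner diag_poly r - horner diag_poly l = (r - l) * horner (pderiv_list diag_poly) z"
        using MVT2[OF r(1), of "horner diag_poly" "horner (pderiv_list diag_poly)"]
          has_real_derivative_horner by blast
      have "of_int 10 \<le> horner (pderiv_list diag_poly) z"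
        using z l 1 by (intro horner_ge[OF _ cert]) auto
      then have "(r - l) * 10 \<le> (r - l) * horner (pderiv_list diag_poly) z"
        using r by (intro mult_left_mono) auto
      then have ge: "10 * (r - l) \<le> horner diag_poly r"
        using z(3) l(1) by simp
      have "2 / 5 * d \<le> l * d"
        using l(2) d(2) by (intro mult_right_mono) auto
      also have "\<dots> \<le> (r - l) ^ 2" by (rule d(1))
      also have "\<dots> \<le> (r - l) * (1 / 8)"
        unfolding power2_eq_square using 1 l(2) r(1) by (intro mult_left_mono) auto
      finally have "9 * d < 10 * (r - l)" using r(1) by simp
      moreover have "d * (- 9) \<le> d * horner asym_poly (r ^ 2)"
        using low 1 d(2) by (intro mult_left_mono) auto
      ultimately show ?thesis using ge by linarith
    next
      case 2
      have cert: "1 * 64 ^ (length diag_poly - 1) \<le> horner_bound 3 (taylor 34 64 diag_poly)"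
        by code_simp
      have "of_int 1 \<le> horner diag_poly r"
        using 2 by (intro horner_ge[OF _ cert]) auto
      moreover have "2 / 5 * d \<le> l * d"
        using l(2) d(2) by (intro mult_right_mono) auto
      moreover have "(r - l) ^ 2 \<le> (1 / 6) ^ 2"
        using 2 l(2) r(1) by (intro power_mono) auto
      moreover have "d * (- 9) \<le> d * horner asym_poly (r ^ 2)"
        using low 2 d(2) by (intro mult_left_mono) auto
      ultimately show ?thesis
        using d(1) by (simp add: power2_eq_square)
    next
      case 3
      have "(0 :: int) < horner_bound 2 (taylor 10 32 asym_poly)"
        by code_simp
      moreover have "(37 / 64) ^ 2 < r ^ 2" "r ^ 2 < (1176119 / 2000000) ^ 2"
        using 3 r m by (auto intro!: power_strict_mono)
      ultimately have "0 < horner asym_poly (r ^ 2)"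
        using horner_pos[of 32 2 10 asym_poly "r ^ 2"] by (simp add: power2_eq_square)
      then show ?thesis
        using pos[OF r] d(2) by (simp add: add_pos_nonneg)
    qed
  qed
  then show ?thesis
    unfolding advantage_sign_15[of r d, unfolded r2 t, symmetric] r2 .
qed

text \<open>The intervals of the \<open>diag_sign_\<close> lemmas fill the gaps between those of the
  \<open>diag_root_\<close> lemmas, so that together they cover \<open>[0, 1]\<close>.\<close>

lemma diag_sign_0:
  assumes "0 / 64 \<le> x" "x \<le> 4 / 64"
  shows "0 < horner diag_poly x"
proof -
  have "0 < horner_bound 4 (taylor 0 64 (pscale (1) diag_poly))"
    by code_simp
  then show ?thesis
    using diag_sign[of 4 0 "1" x] assms by simp
qed

lemma diag_sign_8:
  assumes "8 / 64 \<le> x" "x \<le> 12 / 64"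
  shows "horner diag_poly x < 0"
proof -
  have "0 < horner_bound 4 (taylor 8 64 (pscale (-1) diag_poly))"
    by code_simp
  then show ?thesis
    using diag_sign[of 4 8 "-1" x] assms by simp
qed

lemma diag_sign_16:
  assumes "16 / 64 \<le> x" "x \<le> 19 / 64"
  shows "0 < horner diag_poly x"
proof -
  have "0 < horner_bound 3 (taylor 16 64 (pscale (1) diag_poly))"
    by code_simp
  then show ?thesis
    using diag_sign[of 3 16 "1" x] assms by simp
qed

lemma diag_sign_24:
  assumes "24 / 64 \<le> x" "x \<le> 28 / 64"
  shows "horner diag_poly x < 0"
proof -
  have "0 < horner_bound 4 (taylor 24 64 (pscale (-1) diag_poly))"
    by code_simp
  then show ?thesis
    using diag_sign[of 4 24 "-1" x] assms by simp
qed

lemma diag_sign_34: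
  assumes "34 / 64 \<le> x" "x \<le> 37 / 64"
  shows "0 < horner diag_poly x"
proof -
  have "0 < horner_bound 3 (taylor 34 64 (pscale (1) diag_poly))"
    by code_simp
  then show ?thesis
    using diag_sign[of 3 34 "1" x] assms by simp
qed

lemma diag_sign_44:
  assumes "44 / 64 \<le> x" "x \<le> 48 / 64"
  shows "horner diag_poly x < 0"
proof -
  have "0 < horner_bound 4 (taylor 44 64 (pscale (-1) diag_poly))"
    by code_simp
  then show ?thesis
    using diag_sign[of 4 44 "-1" x] assms by simp
qed

lemma diag_sign_57:
  assumes "57 / 64 \<le> x" "x \<le> 60 / 64"
  shows "0 < horner diag_poly x"
proof -
  have "0 < horner_bound 3 (taylor 57 64 (pscale (1) diag_poly))"
    by code_simp
  then show ?thesis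
    using diag_sign[of 3 57 "1" x] assms by simp
qed

section \<open>Transfer from the polynomial to the first-serve advantage\<close>

lemma sgn_diag:
  assumes "0 < x" "x < 1"
  shows "sgn (first_serve_advantage 15 x x) = sgn (horner diag_poly (1 - x))"
  using sgn_first_serve_advantage[of x x 15] advantage_sign_15[of "1 - x" 0] assms
  by (simp add: power2_eq_square)

text \<open>Halving the scaled bounds places \<open>10 ^ 6 * (1 - r)\<close> strictly within one
  half of \<open>k\<close>, so no tie in rounding can occur.\<close>

lemma round_root:
  fixes r :: real
  assumes "of_int (2000000 - 2 * k) - 1 < 2000000 * r" "2000000 * r < of_int (2000000 - 2 * k) + 1"
  shows "round (10 ^ 6 * (1 - r)) = k"
proof (rule round_unique')
  show "\<bar>10 ^ 6 * (1 - r) - of_int k\<bar> < 1 / 2"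
    unfolding abs_less_iff using assms by simp
qed

lemma sgn_eqD:
  fixes a b :: real
  assumes "sgn a = sgn b"
  shows "0 < a \<longleftrightarrow> 0 < b" "a < 0 \<longleftrightarrow> b < 0" "a = 0 \<longleftrightarrow> b = 0"
  using assms by (auto simp: sgn_if split: if_splits)

theorem mainTheorem3:
  shows "\<exists>x1 x2 x3 x4 x5 x6 x7 :: real.
    0 < x1 \<and> x1 < x2 \<and> x2 < x3 \<and> x3 < x4 \<and> x4 < x5 \<and> x5 < x6 \<and> x6 < x7 \<and> x7 < 1 \<and>
    {x \<in> {0<..<1}. first_serve_advantage 15 x x = 0} = {x1, x2, x3, x4, x5, x6, x7} \<and>
    round (10 ^ 6 * x1) = 53458 \<and>
    round (10 ^ 6 * x2) = 247565 \<and>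
    round (10 ^ 6 * x3) = 411942 \<and>
    round (10 ^ 6 * x4) = 555784 \<and>
    round (10 ^ 6 * x5) = 685200 \<and>
    round (10 ^ 6 * x6) = 804458 \<and>
    round (10 ^ 6 * x7) = 916374 \<and>
    (\<forall>x \<in> {x1<..<x2} \<union> {x3<..<x4} \<union> {x5<..<x6} \<union> {x7<..<1}.
       first_serve_advantage 15 x x > 0) \<and>
    (\<forall>x \<in> {0<..<x1} \<union> {x2<..<x3} \<union> {x4<..<x5} \<union> {x6<..<x7}.
       first_serve_advantage 15 x x < 0) \<and>
    (\<forall>pA \<in> {x3<..<x4}. \<forall>pB \<in> {x3<..<x4}. first_serve_advantage 15 pA pB > 0)"
proof -
  \<comment> \<open>The argument of the polynomial is \<open>1 - x\<close>, so the roots come in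
    reverse order: \<open>x1 = 1 - r7\<close> up to \<open>x7 = 1 - r1\<close>.\<close>
  let ?g = "horner diag_poly"
  obtain r1 where r1: "167251 < 2000000 * r1" "2000000 * r1 < 167253" "?g r1 = 0"
    "\<And>x. 4 / 64 \<le> x \<Longrightarrow> x < r1 \<Longrightarrow> 0 < ?g x"
    "\<And>x. r1 < x \<Longrightarrow> x \<le> 8 / 64 \<Longrightarrow> ?g x < 0"
    using diag_root_1 by blast
  obtain r2 where r2: "391083 < 2000000 * r2" "2000000 * r2 < 391085" "?g r2 = 0"
    "\<And>x. 12 / 64 \<le> x \<Longrightarrow> x < r2 \<Longrightarrow> ?g x < 0"
    "\<And>x. r2 < x \<Longrightarrow> x \<le> 16 / 64 \<Longrightarrow> 0 < ?g x"
    using diag_root_2 by blast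
  obtain r3 where r3: "629599 < 2000000 * r3" "2000000 * r3 < 629601" "?g r3 = 0"
    "\<And>x. 19 / 64 \<le> x \<Longrightarrow> x < r3 \<Longrightarrow> 0 < ?g x"
    "\<And>x. r3 < x \<Longrightarrow> x \<le> 24 / 64 \<Longrightarrow> ?g x < 0"
    using diag_root_3 by blast
  obtain r4 where r4: "888431 < 2000000 * r4" "2000000 * r4 < 888433" "?g r4 = 0"
    "\<And>x. 28 / 64 \<le> x \<Longrightarrow> x < r4 \<Longrightarrow> ?g x < 0"
    "\<And>x. r4 < x \<Longrightarrow> x \<le> 34 / 64 \<Longrightarrow> 0 < ?g x"
    using diag_root_4 by blast
  obtain r5 where r5: "1176115 < 2000000 * r5" "2000000 * r5 < 1176117" "?g r5 = 0"
    "\<And>x. 37 / 64 \<le> x \<Longrightarrow> x < r5 \<Longrightarrow> 0 < ?g x"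
    "\<And>x. r5 < x \<Longrightarrow> x \<le> 44 / 64 \<Longrightarrow> ?g x < 0"
    using diag_root_5 by blast
  obtain r6 where r6: "1504869 < 2000000 * r6" "2000000 * r6 < 1504871" "?g r6 = 0"
    "\<And>x. 48 / 64 \<le> x \<Longrightarrow> x < r6 \<Longrightarrow> ?g x < 0"
    "\<And>x. r6 < x \<Longrightarrow> x \<le> 57 / 64 \<Longrightarrow> 0 < ?g x"
    using diag_root_6 by blast
  obtain r7 where r7: "1893083 < 2000000 * r7" "2000000 * r7 < 1893085" "?g r7 = 0"
    "\<And>x. 60 / 64 \<le> x \<Longrightarrow> x < r7 \<Longrightarrow> 0 < ?g x"
    "\<And>x. r7 < x \<Longrightarrow> x \<le> 64 / 64 \<Longrightarrow> ?g x < 0"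
    using diag_root_7 by blast
  have pos: "0 < ?g x" if "0 < x \<and> x < r1 \<or> r2 < x \<and> x < r3 \<or> r4 < x \<and> x < r5 \<or> r6 < x \<and> x < r7" for x
    using that
  proof (elim disjE conjE)
    assume "0 < x" "x < r1"
    then show ?thesis using diag_sign_0[of x] r1(4)[of x] by linarith
  next
    assume "r2 < x" "x < r3"
    then show ?thesis using r2(5)[of x] diag_sign_16[of x] r3(4)[of x] by linarith
  next
    assume "r4 < x" "x < r5"
    then show ?thesis using r4(5)[of x] diag_sign_34[of x] r5(4)[of x] by linarith
  next
    assume "r6 < x" "x < r7"
    then show ?thesis using r6(5)[of x] diag_sign_57[of x] r7(4)[of x] by linarith
  qed
  have neg: "?g x < 0" if "r1 < x \<and> x < r2 \<or> r3 < x \<and> x < r4 \<or> r5 < x \<and> x < r6 \<or> r7 < x \<and> x < 1" for x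
    using that
  proof (elim disjE conjE)
    assume "r1 < x" "x < r2"
    then show ?thesis using r1(5)[of x] diag_sign_8[of x] r2(4)[of x] by linarith
  next
    assume "r3 < x" "x < r4"
    then show ?thesis using r3(5)[of x] diag_sign_24[of x] r4(4)[of x] by linarith
  next
    assume "r5 < x" "x < r6"
    then show ?thesis using r5(5)[of x] diag_sign_44[of x] r6(4)[of x] by linarith
  next
    assume "r7 < x" "x < 1"
    then show ?thesis using r7(5)[of x] by linarith
  qed
  have order: "0 < r1" "r1 < r2" "r2 < r3" "r3 < r4" "r4 < r5" "r5 < r6" "r6 < r7" "r7 < 1"
    using r1(1,2) r2(1,2) r3(1,2) r4(1,2) r5(1,2) r6(1,2) r7(1,2) by linarith+
  have f_pos: "0 < first_serve_advantage 15 x x \<longleftrightarrow> 0 < ?g (1 - x)"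
    and f_neg: "first_serve_advantage 15 x x < 0 \<longleftrightarrow> ?g (1 - x) < 0"
    and f_0: "first_serve_advantage 15 x x = 0 \<longleftrightarrow> ?g (1 - x) = 0" if "0 < x" "x < 1" for x
    by (rule sgn_eqD[OF sgn_diag[OF that]])+
  have zeros: "?g y = 0 \<longleftrightarrow> y \<in> {r1, r2, r3, r4, r5, r6, r7}" if "0 < y" "y < 1" for y
  proof
    assume "?g y = 0"
    then have "\<not> (0 < y \<and> y < r1 \<or> r2 < y \<and> y < r3 \<or> r4 < y \<and> y < r5 \<or> r6 < y \<and> y < r7)"
      "\<not> (r1 < y \<and> y < r2 \<or> r3 < y \<and> y < r4 \<or> r5 < y \<and> y < r6 \<or> r7 < y \<and> y < 1)"
      using pos[of y] neg[of y] by (metis less_irrefl)+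
    then show "y \<in> {r1, r2, r3, r4, r5, r6, r7}"
      unfolding insert_iff empty_iff using that by linarith
  qed (use r1(3) r2(3) r3(3) r4(3) r5(3) r6(3) r7(3) in auto)
  have "{x \<in> {0<..<1}. first_serve_advantage 15 x x = 0}
      = {1 - r7, 1 - r6, 1 - r5, 1 - r4, 1 - r3, 1 - r2, 1 - r1}" (is "?Z = ?R")
  proof (intro set_eqI iffI)
    fix x assume "x \<in> ?Z"
    then have "1 - x \<in> {r1, r2, r3, r4, r5, r6, r7}"
      using f_0[of x] zeros[of "1 - x"] by simp
    then show "x \<in> ?R" by auto
  next
    fix x assume x: "x \<in> ?R"
    then have "0 < x" "x < 1" using order by auto
    moreover from x have "1 - x \<in> {r1, r2, r3, r4, r5, r6, r7}" by auto
    ultimately show "x \<in> ?Z"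
      using f_0[of x] zeros[of "1 - x"] by simp
  qed
  moreover have "round (10 ^ 6 * (1 - r7)) = 53458" "round (10 ^ 6 * (1 - r6)) = 247565"
    "round (10 ^ 6 * (1 - r5)) = 411942" "round (10 ^ 6 * (1 - r4)) = 555784"
    "round (10 ^ 6 * (1 - r3)) = 685200" "round (10 ^ 6 * (1 - r2)) = 804458"
    "round (10 ^ 6 * (1 - r1)) = 916374"
    by (rule round_root; use r1(1,2) r2(1,2) r3(1,2) r4(1,2) r5(1,2) r6(1,2) r7(1,2) in simp)+
  moreover have "\<forall>x \<in> {1 - r7<..<1 - r6} \<union> {1 - r5<..<1 - r4} \<union> {1 - r3<..<1 - r2} \<union> {1 - r1<..<1}.
       first_serve_advantage 15 x x > 0"
  proof
    fix x assume x: "x \<in> {1 - r7<..<1 - r6} \<union> {1 - r5<..<1 - r4} \<union> {1 - r3<..<1 - r2} \<union> {1 - r1<..<1}"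
    then have "0 < x" "x < 1" using order by auto
    moreover have "0 < ?g (1 - x)" using x by (intro pos) auto
    ultimately show "first_serve_advantage 15 x x > 0" by (simp add: f_pos)
  qed
  moreover have "\<forall>x \<in> {0<..<1 - r7} \<union> {1 - r6<..<1 - r5} \<union> {1 - r4<..<1 - r3} \<union> {1 - r2<..<1 - r1}.
       first_serve_advantage 15 x x < 0"
  proof
    fix x assume x: "x \<in> {0<..<1 - r7} \<union> {1 - r6<..<1 - r5} \<union> {1 - r4<..<1 - r3} \<union> {1 - r2<..<1 - r1}"
    then have "0 < x" "x < 1" using order by auto
    moreover have "?g (1 - x) < 0" using x by (intro neg) auto
    ultimately show "first_serve_advantage 15 x x < 0" by (simp add: f_neg)
  qed
  moreover have "\<forall>pA \<in> {1 - r5<..<1 - r4}. \<forall>pB \<in> {1 - r5<..<1 - r4}. first_serve_advantage 15 pA pB > 0"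
  proof (intro ballI)
    fix a b assume ab: "a \<in> {1 - r5<..<1 - r4}" "b \<in> {1 - r5<..<1 - r4}"
    then have "0 < advantage_sign 15 ((1 - a) * (1 - b)) ((1 - a) + (1 - b))"
      \<comment> \<open>Reflection turns the square between \<open>x3\<close> and \<open>x4\<close>
        into the one between \<open>r4\<close> and \<open>r5\<close>, with the delicate corner at
        \<open>r4\<close>.\<close>
      using r4(1) r5(2) by (intro advantage_sign_square_pos[of r4 r5] pos r4(3)) auto
    moreover have "0 < a" "a < 1" "0 < b" "b < 1" using ab order by auto
    ultimately show "first_serve_advantage 15 a b > 0"
      using sgn_eqD(1)[OF sgn_first_serve_advantage[of a b 15]] by simp
  qed
  ultimately show ?thesis
    using order
    by - (rule exI[of _ "1 - r7"], rule exI[of _ "1 - r6"], rule exI[of _ "1 - r5"], rule exI[of _ "1 - r4"],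
        rule exI[of _ "1 - r3"], rule exI[of _ "1 - r2"], rule exI[of _ "1 - r1"],
        intro conjI; (assumption | linarith))
qed

end
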